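(* Let $m\ge 2$ be an integer and $a>0$, and consider the polynomial regression models of degree $m-2$ and $m$ on the design space $[-a,a]$. Let $\mathcal{B}\subseteq(-\infty,\infty)$, and let $\xi_{m,\beta}$ be the designs on $[-a,a]$ defined in the context. (1) Let $\bar\pi$ denote a symmetric prior distribution on $\mathcal{B}$ with existing second moment, and define $$\beta_B=\min\Bigl\{1,\ \frac{\int_{\mathcal{B}}b^2\,\bar\pi(db)}{a^2}\Bigr\}.$$ Then the design $\xi_{m,\beta_B}$ is a Bayesian $T$-optimal discriminating design (with respect to $\bar\pi$) on the interval $[-a,a]$ for the polynomial regression models of degree $m-2$ and $m$. (2) Define $\beta_M=1-2h^*$, where $h^*$ is the unique maximizer in the interval $[0,\tfrac12]$ of the function $$h\ \mapsto\ \inf_{b\in\mathcal{B}}\frac{b^2+a^2h}{a^2\,\bar R(b,a)}\,(1-h),$$ with $$\bar R(b,a)=\inf_{q_0,\ldots,q_{m-2}\in\mathbb{R}}\ \sup_{x\in[-1,1]}a^{2m}\Bigl|x^m+\frac{b}{a}x^{m-1}+q_{m-2}x^{m-2}+\cdots+q_1x+q_0\Bigr|^2.$$ Then the design $\xi_{m,\beta_M}$ is a standardized maximin $T$-optimal discriminating design (with respect to $\mathcal{B}$) on the interval $[-a,a]$ for the polynomial regression models of degree $m-2$ and $m$.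
   Context: An approximate design is a probability measure $\xi$ on $[-a,a]$ with finite support. Optimality criteria. The competing models are $\eta_1(x,\theta_1)=\sum_{i=0}^{m-2}\theta_{1,i}x^i$ and $\eta_2(x,\theta_2)=\sum_{i=0}^{m}\theta_{2,i}x^i$, and $b\in\mathcal{B}$ represents the ratio $\theta_{2,m-1}/\theta_{2,m}$. For a design $\xi$ and $b\in\mathbb{R}$ put $$\bar T(\xi,b)=\inf_{q_0,\ldots,q_{m-2}\in\mathbb{R}}\int_{-a}^{a}\Bigl(\sum_{i=0}^{m-2}q_ix^i-bx^{m-1}-x^m\Bigr)^2\xi(dx).$$ A design is Bayesian $T$-optimal discriminating with respect to $\bar\pi$ if it maximizes $V_B(\xi)=\int_{\mathcal{B}}\bar T(\xi,b)\,\bar\pi(db)$ among all approximate designs. A design is standardized maximin $T$-optimal discriminating with respect to $\mathcal{B}$ if it maximizes $V_M(\xi)=\inf_{b\in\mathcal{B}}\bar T(\xi,b)/\bar R(b)$ among all approximate designs, where $\bar R(b)=\max_{\xi}\bar T(\xi,b)$ (maximum over all approximate designs). The designs $\xi_{m,\beta}$, $\beta\ge0$. Let $U_n(x)=\sin((n+1)\arccos x)/\sin(\arccos x)$ denote the Chebyshev polynomial of the second kind (so that $U_{-1}=0$). If $\beta=1$, the design $\xi_{m,1}$ puts masses $1/(2(m-1))$ at each of the points $-a$ and $a$, and masses $1/(m-1)$ at each of the $m-2$ roots of the polynomial $U_{m-2}(x/a)$. If $\beta\ne1$, the design $\xi_{m,\beta}$ is supported at the $m+1$ roots $-a=x_0<x_1<\cdots<x_{m-1}<x_m=a$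 of the polynomial $$(x^2-a^2)\Bigl\{U_{m-1}\Bigl(\frac{x}{a}\Bigr)+\beta\,U_{m-3}\Bigl(\frac{x}{a}\Bigr)\Bigr\},$$ with weights $$\xi_{m,\beta}(\mp a)=\frac{1+\beta}{2[m+\beta(m-2)]},$$ $$\xi_{m,\beta}(x_j)=\Bigl[m-1-\frac{(1+\beta)U_{m-2}(x_j/a)}{U_m(x_j/a)+\beta U_{m-2}(x_j/a)}\Bigr]^{-1},\qquad j=1,\ldots,m-1.$$
   Formalization: Part (2) is stated for nonempty B that is symmetric about 0 (B = -B); for arbitrary B it is false, e.g. m=2, a=1, B={1} gives h*=0 and the design with mass 1/2 at -1 and 1, whose value 1 is below the maximum 81/64. *)

theory Defs
  imports "HOL-Probability.Probability" "HOL-Computational_Algebra.Polynomial"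
begin

(* Chebyshev polynomials of the second kind. The auxiliary index is shifted by one, so that
   cheb_U (-1) = 0 and cheb_U 0 = 1; the lemmas cheb_U_cos and cheb_U_arccos recover the
   trigonometric formula. Taking polynomials rather than the quotient of sines gives the right
   values at the points -1, 1 as well. *)

fun cheb_U_aux :: "nat \<Rightarrow> real poly" where
  "cheb_U_aux 0 = 0"
| "cheb_U_aux (Suc 0) = 1"
| "cheb_U_aux (Suc (Suc n)) = [:0, 2:] * cheb_U_aux (Suc n) - cheb_U_aux n"

definition cheb_U :: "int \<Rightarrow> real poly" where
  "cheb_U n = cheb_U_aux (nat (n + 1))"

lemma cheb_U_aux_cos: "poly (cheb_U_aux n) (cos t) * sin t = sin (real n * t)"
proof (induction n rule: cheb_U_aux.induct)
  case (3 n)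
  have "poly (cheb_U_aux (Suc (Suc n))) (cos t) * sin t
      = 2 * cos t * (poly (cheb_U_aux (Suc n)) (cos t) * sin t)
        - poly (cheb_U_aux n) (cos t) * sin t"
    by (simp add: algebra_simps)
  also have "\<dots> = 2 * cos t * sin (real (Suc n) * t) - sin (real n * t)"
    using 3 by simp
  also have "\<dots> = sin (real (Suc n) * t + t)"
  proof -
    have "sin (real n * t) = sin (real (Suc n) * t - t)"
      by (simp add: algebra_simps)
    then show ?thesis
      by (simp only: sin_add sin_diff) (simp add: algebra_simps)
  qed
  also have "real (Suc n) * t + t = real (Suc (Suc n)) * t"
    by (simp add: algebra_simps)
  finally show ?case .
qed auto

lemma cheb_U_cos:
  assumes "n \<ge> -1"
  shows "poly (cheb_U n) (cos t) * sin t = sin (of_int (n + 1) * t)"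
  using cheb_U_aux_cos[of "nat (n + 1)" t] assms by (simp add: cheb_U_def)

lemma cheb_U_arccos:
  assumes "n \<ge> -1" "-1 < x" "x < 1"
  shows "poly (cheb_U n) x = sin (of_int (n + 1) * arccos x) / sin (arccos x)"
proof -
  have "sin (arccos x) \<noteq> 0"
    using assms sin_arccos_nonzero by auto
  with cheb_U_cos[OF assms(1), of "arccos x"] assms show ?thesis
    by (simp add: field_simps)
qed

definition approximate_design :: "real \<Rightarrow> real pmf \<Rightarrow> bool" where
  "approximate_design a \<xi> \<longleftrightarrow> finite (set_pmf \<xi>) \<and> set_pmf \<xi> \<subseteq> {-a..a}"

(* Only q 0, ..., q (m - 2) matter in the infimum; m >= 2 throughout. *)
definition Tbar :: "nat \<Rightarrow> real pmf \<Rightarrow> real \<Rightarrow> real" where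
  "Tbar m \<xi> b = (INF q :: nat \<Rightarrow> real.
     measure_pmf.expectation \<xi> (\<lambda>x. ((\<Sum>i\<le>m - 2. q i * x ^ i) - b * x ^ (m - 1) - x ^ m)\<^sup>2))"

definition V_B :: "nat \<Rightarrow> real measure \<Rightarrow> real pmf \<Rightarrow> real" where
  "V_B m \<pi> \<xi> = (\<integral>b. Tbar m \<xi> b \<partial>\<pi>)"

definition bayesian_T_optimal :: "nat \<Rightarrow> real \<Rightarrow> real measure \<Rightarrow> real pmf \<Rightarrow> bool" where
  "bayesian_T_optimal m a \<pi> \<xi> \<longleftrightarrow> is_arg_max (V_B m \<pi>) (approximate_design a) \<xi>"

definition Rbar :: "nat \<Rightarrow> real \<Rightarrow> real \<Rightarrow> real" where
  "Rbar m a b = (SUP \<xi> \<in> Collect (approximate_design a). Tbar m \<xi> b)"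

definition V_M :: "nat \<Rightarrow> real \<Rightarrow> real set \<Rightarrow> real pmf \<Rightarrow> real" where
  "V_M m a B \<xi> = (INF b \<in> B. Tbar m \<xi> b / Rbar m a b)"

definition standardized_maximin_T_optimal ::
    "nat \<Rightarrow> real \<Rightarrow> real set \<Rightarrow> real pmf \<Rightarrow> bool" where
  "standardized_maximin_T_optimal m a B \<xi> \<longleftrightarrow>
     is_arg_max (V_M m a B) (approximate_design a) \<xi>"

definition xi_poly :: "nat \<Rightarrow> real \<Rightarrow> real \<Rightarrow> real \<Rightarrow> real" where
  "xi_poly m a \<beta> x = (x\<^sup>2 - a\<^sup>2) *
     (poly (cheb_U (int m - 1)) (x / a) + \<beta> * poly (cheb_U (int m - 3)) (x / a))"

(* The mass function of the design \<xi>_{m,\<beta>}, as a function on the whole real line. *)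
definition xi_mass :: "nat \<Rightarrow> real \<Rightarrow> real \<Rightarrow> real \<Rightarrow> real" where
  "xi_mass m a \<beta> x =
    (if \<beta> = 1 then
       (if x = -a \<or> x = a then 1 / (2 * (real m - 1))
        else if poly (cheb_U (int m - 2)) (x / a) = 0 then 1 / (real m - 1)
        else 0)
     else if xi_poly m a \<beta> x \<noteq> 0 then 0
     else if x = -a \<or> x = a then (1 + \<beta>) / (2 * (real m + \<beta> * (real m - 2)))
     else inverse (real m - 1 -
       (1 + \<beta>) * poly (cheb_U (int m - 2)) (x / a) /
         (poly (cheb_U (int m)) (x / a) + \<beta> * poly (cheb_U (int m - 2)) (x / a))))"

(* A probability measure on the possibly non-measurable set B: the sigma-algebra is the trace of
   the Borel sets. Symmetry is that of the induced distribution on the real line. *)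
definition symmetric_prior :: "real set \<Rightarrow> real measure \<Rightarrow> bool" where
  "symmetric_prior B \<pi> \<longleftrightarrow> prob_space \<pi> \<and> space \<pi> = B \<and> sets \<pi> = sets (restrict_space borel B) \<and>
     distr \<pi> borel uminus = distr \<pi> borel (\<lambda>b. b)"

definition beta_B :: "real \<Rightarrow> real measure \<Rightarrow> real" where
  "beta_B a \<pi> = min 1 ((\<integral>b. b\<^sup>2 \<partial>\<pi>) / a\<^sup>2)"

definition Rbar_minimax :: "nat \<Rightarrow> real \<Rightarrow> real \<Rightarrow> real" where
  "Rbar_minimax m b a = (INF q :: nat \<Rightarrow> real. SUP x \<in> {-1..1}.
     a ^ (2 * m) * \<bar>x ^ m + b / a * x ^ (m - 1) + (\<Sum>i\<le>m - 2. q i * x ^ i)\<bar>\<^sup>2)"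

definition maximin_fun :: "nat \<Rightarrow> real \<Rightarrow> real set \<Rightarrow> real \<Rightarrow> real" where
  "maximin_fun m a B h = (INF b \<in> B. (b\<^sup>2 + a\<^sup>2 * h) / (a\<^sup>2 * Rbar_minimax m b a) * (1 - h))"

definition is_h_star :: "nat \<Rightarrow> real \<Rightarrow> real set \<Rightarrow> real \<Rightarrow> bool" where
  "is_h_star m a B h \<longleftrightarrow> is_arg_max (maximin_fun m a B) (\<lambda>h. h \<in> {0..1/2}) h"

definition beta_M :: "nat \<Rightarrow> real \<Rightarrow> real set \<Rightarrow> real" where
  "beta_M m a B = 1 - 2 * (THE h. is_h_star m a B h)"

end

theory Submission
  imports Defs
begin

text \<open>
Write \<open>n = m - 1\<close>, rescale to \<open>a = 1\<close> and put \<open>s = b\<^sup>2\<close>. With the Chebyshev polynomials \<open>T\<^sub>j\<close> and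
\<open>U\<^sub>j\<close> of the first and second kind let \<open>J = T\<^sub>m - \<beta> T\<^bsub>m-2\<^esub>\<close> and
\<open>G = U\<^bsub>m-1\<^esub> + \<beta> U\<^bsub>m-3\<^esub>\<close>. For every \<open>b\<close> the polynomial \<open>(J + 2 b T\<^bsub>m-1\<^esub>) / 2\<^sup>n\<close> has the
prescribed leading coefficients \<open>1\<close> and \<open>b\<close>, so that its mean square bounds \<open>Tbar\<close> from above,
for every design. The Pell equation \<open>T\<^sub>n\<^sup>2 - (x\<^sup>2 - 1) U\<^bsub>n-1\<^esub>\<^sup>2 = 1\<close> yields the identity
\<open>J\<^sup>2 + 4 \<beta> T\<^sub>n\<^sup>2 = (1 + \<beta>)\<^sup>2 - (1 - x\<^sup>2) G\<^sup>2\<close> (lemma \<open>equioscillation_defect\<close>): the weighted sum of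
squares on the left is at most \<open>(1 + \<beta>)\<^sup>2\<close> on \<open>[-1, 1]\<close>, with equality exactly at the roots of
\<open>(x\<^sup>2 - 1) G\<close>, which carry the design \<open>\<xi>\<^bsub>m,\<beta>\<^esub>\<close>.

That this design attains the bound is an orthogonality statement. The weight of a node \<open>x\<close> is
\<open>K(x) / N'(x)\<close> with \<open>N = (x\<^sup>2 - 1) G\<close> and \<open>K = T\<^sub>m + \<beta> T\<^bsub>m-2\<^esub>\<close>, and at the nodes
\<open>K T\<^sub>n = (1 + \<beta>) x\<close> and \<open>K J = 1 - \<beta>\<^sup>2\<close>. Hence every moment that is needed has the form
\<open>\<Sum> f(x) / N'(x)\<close> with \<open>f\<close> of degree at most \<open>m\<close>, which Lagrange interpolation evaluates as the
coefficient of \<open>f\<close> at \<open>x\<^sup>m\<close> divided by the leading coefficient of \<open>N\<close>. Both \<open>J\<close> and \<open>T\<^sub>n\<close> turn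
out to be orthogonal to all polynomials of degree at most \<open>m - 2\<close>, and \<open>Tbar\<close> at \<open>\<xi>\<^bsub>m,\<beta>\<^esub>\<close>
equals \<open>(1 + \<beta>) (2 s + 1 - \<beta>) / 4\<^sup>n\<close> (lemma \<open>xi_design\<close>). For \<open>\<beta> = 1\<close> the nodes are the
extremal points of \<open>T\<^sub>n\<close>, and the same argument runs with \<open>(x\<^sup>2 - 1) U\<^bsub>n-1\<^esub>\<close> in place of \<open>N\<close>.

For the Bayesian criterion the term of \<open>Tbar\<close> that is linear in \<open>b\<close> integrates to zero, \<open>s\<close> becomes
the second moment of the prior, and the choice \<open>\<beta> = min 1 s\<close> makes the upper bound coincide with the
value at \<open>\<xi>\<^bsub>m,\<beta>\<^esub>\<close> (lemma \<open>bayesian_optimal\<close>).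

For the maximin criterion, averaging over \<open>b\<close> and \<open>-b\<close> removes the linear term. An arbitrary design
enters only through the mean squares of \<open>J\<close> and \<open>T\<^sub>n\<close>; choosing \<open>\<beta>\<close> according to the latter shows
that some \<open>\<xi>\<^bsub>m,\<beta>\<^esub>\<close> is at least as good for all \<open>b\<close> simultaneously (lemma
\<open>design_dominated\<close>). So only the one-parameter family remains, and there the criterion is a multiple of
\<open>maximin_fun\<close> at \<open>h = (1 - \<beta>) / 2\<close>. This comparison requires that the largest value \<open>Rbar\<close> of \<open>Tbar\<close>
is the best uniform approximation error \<open>Rbar_minimax\<close>. No closed form is used: a
perturbation argument shows that a nearly optimal design has a nearly optimal residual that is nowhere
much larger than its mean square (lemmas \<open>near_minimax_step\<close> and \<open>Rbar_minimax_eq\<close>). Finally the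
maximizer \<open>h\<^sup>*\<close> exists because \<open>maximin_fun\<close> is Lipschitz, and is unique because the functions
under the infimum exceed their smaller end value at the midpoint of an interval by an amount that does
not depend on \<open>b\<close> (lemma \<open>rel_eff_midpoint\<close>).
\<close>

section \<open>Lagrange interpolation and sums over the roots of a polynomial\<close>

definition other_nodes :: "real set \<Rightarrow> real \<Rightarrow> real poly" where
  "other_nodes X x = (\<Prod>y\<in>X - {x}. [:-y, 1:])"

lemma poly_other_nodes_self:
  assumes "finite X" shows "poly (other_nodes X x) x \<noteq> 0"
  using assms by (auto simp: other_nodes_def poly_prod)

lemma poly_other_nodes_other:
  assumes "finite X" "y \<in> X" "y \<noteq> x" shows "poly (other_nodes X x) y = 0"
  using assms by (auto simp: other_nodes_def poly_prod intro!: prod_zero)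

lemma degree_other_nodes:
  assumes "finite X" "x \<in> X" shows "degree (other_nodes X x) = card X - 1"
proof -
  have "degree (other_nodes X x) = (\<Sum>y\<in>X - {x}. degree [:-y, 1:])"
    unfolding other_nodes_def by (intro degree_prod_eq_sum_degree) auto
  then show ?thesis using assms by simp
qed

lemma lead_coeff_other_nodes: "lead_coeff (other_nodes X x) = 1"
  by (simp add: other_nodes_def lead_coeff_prod)

lemma lagrange_interpolation:
  assumes "finite X" "degree f < card X"
  shows "f = (\<Sum>x\<in>X. smult (poly f x / poly (other_nodes X x) x) (other_nodes X x))"
    (is "f = ?g")
proof (rule poly_eqI_degree)
  fix x assume x: "x \<in> X"
  have "poly ?g x = (\<Sum>y\<in>X. if y = x then poly f x else 0)"
    unfolding poly_sum using assms x
    by (intro sum.cong) (auto simp: poly_other_nodes_self poly_other_nodes_other)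
  then show "poly f x = poly ?g x" using assms x by simp
next
  have "degree ?g \<le> card X - 1"
    using assms by (intro degree_sum_le) (auto simp: degree_other_nodes)
  then show "degree ?g < card X" using assms by linarith
qed (use assms in simp)

text \<open>Up to the leading coefficient of \<open>N\<close> the left-hand side is the top coefficient of the Lagrange
interpolation polynomial of \<open>f\<close>, which is \<open>f\<close> itself. In particular the sum vanishes if the degree of \<open>f\<close> is at most \<open>card X - 2\<close>; all
orthogonality relations of the designs come from this.\<close>

lemma nodal_derivative_quadrature:
  fixes N f :: "real poly"
  assumes X: "finite X" and N: "degree N = card X" "\<And>x. x \<in> X \<Longrightarrow> poly N x = 0"
    and f: "degree f < card X"
  shows "(\<Sum>x\<in>X. poly f x / poly (pderiv N) x) = coeff f (card X - 1) / lead_coeff N"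
    and "x \<in> X \<Longrightarrow> poly (pderiv N) x \<noteq> 0"
proof -
  define c where "c = lead_coeff N"
  have "N \<noteq> 0" using N f by auto
  then have c: "c \<noteq> 0" by (simp add: c_def)
  define M where "M = (\<Prod>y\<in>X. [:-y, 1:])"
  have degM: "degree M = card X"
    unfolding M_def by (subst degree_prod_eq_sum_degree) auto
  have lM: "lead_coeff M = 1" by (simp add: M_def lead_coeff_prod)
  have NM: "N = smult c M"
  proof (rule poly_eqI_degree_lead_coeff[where A = X and n = "card X"])
    show "coeff N (card X) = coeff (smult c M) (card X)"
      using degM lM N(1) by (simp add: c_def)
    show "poly N x = poly (smult c M) x" if "x \<in> X" for x
      using that X N(2) by (auto simp: M_def poly_prod intro!: prod_zero)
  qed (use degM N(1) in \<open>auto intro: order.trans[OF degree_smult_le]\<close>)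
  have der: "poly (pderiv N) x = c * poly (other_nodes X x) x" if "x \<in> X" for x
  proof -
    have "M = [:-x, 1:] * other_nodes X x"
      unfolding M_def other_nodes_def using that X by (simp add: prod.remove)
    then have "poly (pderiv M) x = poly (other_nodes X x) x"
      by (simp only: pderiv_mult poly_add poly_mult) (simp add: pderiv_pCons)
    then show ?thesis by (simp add: NM pderiv_smult)
  qed
  show "x \<in> X \<Longrightarrow> poly (pderiv N) x \<noteq> 0"
    using der c X poly_other_nodes_self by auto
  have "coeff f (card X - 1)
      = (\<Sum>x\<in>X. poly f x / poly (other_nodes X x) x * coeff (other_nodes X x) (card X - 1))"
    by (subst lagrange_interpolation[OF X f]) (simp add: coeff_sum)
  also have "\<dots> = (\<Sum>x\<in>X. poly f x / poly (other_nodes X x) x)"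
    using X degree_other_nodes lead_coeff_other_nodes by (intro sum.cong) (auto, metis)
  also have "\<dots> / c = (\<Sum>x\<in>X. poly f x / poly (pderiv N) x)"
    unfolding sum_divide_distrib by (intro sum.cong) (auto simp: der mult.commute)
  finally show "(\<Sum>x\<in>X. poly f x / poly (pderiv N) x) = coeff f (card X - 1) / lead_coeff N"
    by (simp add: c_def)
qed

section \<open>Chebyshev polynomials and the Pell equation\<close>

text \<open>The Chebyshev polynomials of the first kind. In the recursion they are coupled with those of the second
kind, because almost everything below is a polynomial identity in \<open>x\<close>, \<open>T\<^sub>n\<close> and \<open>U\<^bsub>n-1\<^esub>\<close> modulo the
Pell equation. Note that \<open>cheb_U_aux n\<close> is \<open>U\<^bsub>n-1\<^esub>\<close>.\<close>

primrec cheb_T :: "nat \<Rightarrow> real poly" where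
  "cheb_T 0 = 1"
| "cheb_T (Suc n) = [:0, 1:] * cheb_T n + [:-1, 0, 1:] * cheb_U_aux n"

lemma cheb_U_aux_Suc: "cheb_U_aux (Suc n) = [:0, 1:] * cheb_U_aux n + cheb_T n"
proof (induction n)
  case (Suc n)
  have "cheb_T n = cheb_U_aux (Suc n) - [:0, 1:] * cheb_U_aux n" using Suc by simp
  then have "[:0, 1:] * cheb_U_aux (Suc n) + cheb_T (Suc n)
    = ([:0, 1:] + [:0, 1:]) * cheb_U_aux (Suc n)
      + ([:-1, 0, 1:] - [:0, 1:] * [:0, 1:]) * cheb_U_aux n"
    by (simp only: cheb_T.simps) (simp only: algebra_simps)
  also have "[:0, 1:] + [:0, 1:] = ([:0, 2:] :: real poly)" by simp
  also have "[:-1, 0, 1:] - [:0, 1:] * [:0, 1:] = (-1 :: real poly)" by (simp add: one_pCons)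
  finally show ?case by simp
qed simp

lemma cheb_T_cos: "poly (cheb_T n) (cos t) = cos (real n * t)"
proof (induction n)
  case (Suc n)
  have "poly (cheb_T (Suc n)) (cos t)
      = cos t * poly (cheb_T n) (cos t) - (1 - (cos t)\<^sup>2) * poly (cheb_U_aux n) (cos t)"
    by (simp only: cheb_T.simps poly_add poly_mult poly_pCons poly_0)
       (simp add: algebra_simps power2_eq_square)
  also have "(1 - (cos t)\<^sup>2) * poly (cheb_U_aux n) (cos t)
      = sin t * (poly (cheb_U_aux n) (cos t) * sin t)"
    by (simp only: sin_squared_eq[symmetric]) (simp only: power2_eq_square mult_ac)
  also have "cos t * poly (cheb_T n) (cos t) - \<dots> = cos (real n * t + t)"
    unfolding Suc cheb_U_aux_cos by (simp add: cos_add mult.commute)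
  finally show ?case by (simp add: algebra_simps)
qed simp

lemma pell: "(poly (cheb_T n) x)\<^sup>2 - (x\<^sup>2 - 1) * (poly (cheb_U_aux n) x)\<^sup>2 = 1"
proof (induction n)
  case (Suc n)
  have "(poly (cheb_T (Suc n)) x)\<^sup>2 - (x\<^sup>2 - 1) * (poly (cheb_U_aux (Suc n)) x)\<^sup>2
     = (poly (cheb_T n) x)\<^sup>2 - (x\<^sup>2 - 1) * (poly (cheb_U_aux n) x)\<^sup>2"
    by (simp only: cheb_U_aux_Suc cheb_T.simps poly_add poly_mult poly_pCons poly_0)
       (simp add: algebra_simps power2_eq_square)
  then show ?case using Suc by simp
qed simp

text \<open>The second equation is multiplied by \<open>x\<^sup>2 - 1\<close> to be polynomial. It therefore also gives the value of
\<open>U\<^bsub>n-1\<^esub>\<close> at the end points, where the trigonometric formula is void.\<close>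

lemma cheb_derivs:
  "poly (pderiv (cheb_T n)) x = real n * poly (cheb_U_aux n) x"
  "(x\<^sup>2 - 1) * poly (pderiv (cheb_U_aux n)) x
     = real n * poly (cheb_T n) x - x * poly (cheb_U_aux n) x"
proof (induction n)
  case (Suc n)
  show "poly (pderiv (cheb_T (Suc n))) x = real (Suc n) * poly (cheb_U_aux (Suc n)) x"
    using Suc by (simp only: cheb_U_aux_Suc cheb_T.simps pderiv_add pderiv_mult pderiv_pCons
        poly_add poly_mult poly_pCons poly_0 pderiv_0) (simp add: algebra_simps power2_eq_square)
  show "(x\<^sup>2 - 1) * poly (pderiv (cheb_U_aux (Suc n))) x
     = real (Suc n) * poly (cheb_T (Suc n)) x - x * poly (cheb_U_aux (Suc n)) x"
  proof -
    have "(x\<^sup>2 - 1) * poly (pderiv (cheb_U_aux (Suc n))) x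
      = (x\<^sup>2 - 1) * (poly (cheb_U_aux n) x + poly (pderiv (cheb_T n)) x)
        + x * ((x\<^sup>2 - 1) * poly (pderiv (cheb_U_aux n)) x)"
      by (simp only: cheb_U_aux_Suc pderiv_add pderiv_mult pderiv_pCons
        poly_add poly_mult poly_pCons poly_0 pderiv_0) (simp add: algebra_simps)
    also have "\<dots> = real (Suc n) * poly (cheb_T (Suc n)) x - x * poly (cheb_U_aux (Suc n)) x"
      unfolding Suc by (simp only: cheb_U_aux_Suc cheb_T.simps poly_add poly_mult poly_pCons poly_0)
        (simp add: algebra_simps power2_eq_square)
    finally show ?thesis .
  qed
qed (simp_all add: pderiv_1)

text \<open>Both the degree bounds and the parity of the polynomials, in terms of coefficients. Parity is what makes
the second highest coefficient vanish.\<close>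

lemma cheb_coeff_eq_0:
  "n < i \<or> odd (n + i) \<Longrightarrow> coeff (cheb_T n) i = 0"
  "n \<le> i \<or> even (n + i) \<Longrightarrow> coeff (cheb_U_aux n) i = 0"
proof (induction n arbitrary: i)
  case (Suc n)
  have "cheb_T (Suc n) = pCons 0 (cheb_T n) + pCons 0 (pCons 0 (cheb_U_aux n)) - cheb_U_aux n"
    by simp
  moreover have "coeff (cheb_U_aux n) i = 0" if "Suc n < i \<or> odd (Suc n + i)" for i
    using that by (intro Suc) auto
  moreover have "coeff (pCons 0 (pCons 0 (cheb_U_aux n))) i = 0"
    if "Suc n < i \<or> odd (Suc n + i)" for i
    using that Suc(2)[of "i - 2"] by (cases i; cases "i - 1") auto
  moreover have "coeff (pCons 0 (cheb_T n)) i = 0" if "Suc n < i \<or> odd (Suc n + i)" for i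
    using that Suc(1)[of "i - 1"] by (cases i) auto
  ultimately show "coeff (cheb_T (Suc n)) i = 0" if "Suc n < i \<or> odd (Suc n + i)" for i
    using that by simp
  have "cheb_U_aux (Suc n) = pCons 0 (cheb_U_aux n) + cheb_T n"
    by (simp only: cheb_U_aux_Suc) simp
  moreover have "coeff (cheb_T n) i = 0" if "Suc n \<le> i \<or> even (Suc n + i)" for i
    using that by (intro Suc) auto
  moreover have "coeff (pCons 0 (cheb_U_aux n)) i = 0" if "Suc n \<le> i \<or> even (Suc n + i)" for i
    using that Suc(2)[of "i - 1"] by (cases i) auto
  ultimately show "coeff (cheb_U_aux (Suc n)) i = 0" if "Suc n \<le> i \<or> even (Suc n + i)" for i
    using that by simp
qed (auto simp: coeff_1 dest: odd_pos)

lemma cheb_lead_coeff: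
  "coeff (cheb_T (Suc n)) (Suc n) = 2 ^ n"
  "coeff (cheb_U_aux (Suc n)) n = 2 ^ n"
proof (induction n)
  case (Suc n)
  have T: "cheb_T (Suc (Suc n))
    = pCons 0 (cheb_T (Suc n)) + pCons 0 (pCons 0 (cheb_U_aux (Suc n))) - cheb_U_aux (Suc n)"
    by (subst cheb_T.simps(2)) simp
  have U: "cheb_U_aux (Suc (Suc n)) = pCons 0 (cheb_U_aux (Suc n)) + cheb_T (Suc n)"
    by (subst cheb_U_aux_Suc) simp
  show "coeff (cheb_T (Suc (Suc n))) (Suc (Suc n)) = 2 ^ Suc n"
    unfolding T using Suc cheb_coeff_eq_0(2)[of "Suc n" "Suc (Suc n)"]
    by (simp del: cheb_T.simps cheb_U_aux.simps)
  show "coeff (cheb_U_aux (Suc (Suc n))) (Suc n) = 2 ^ Suc n"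
    unfolding U using Suc by (simp del: cheb_T.simps cheb_U_aux.simps)
qed simp_all

lemma cheb_at_pm1:
  assumes "x\<^sup>2 = 1"
  shows "x * poly (cheb_U_aux n) x = real n * poly (cheb_T n) x" "(poly (cheb_T n) x)\<^sup>2 = 1"
  using cheb_derivs(2)[of x n] pell[of n x] assms by simp_all

lemma cheb_T_sq_le: "\<bar>x\<bar> \<le> 1 \<Longrightarrow> (poly (cheb_T n) x)\<^sup>2 \<le> 1"
proof -
  assume "\<bar>x\<bar> \<le> 1"
  then have "(1 - x\<^sup>2) * (poly (cheb_U_aux n) x)\<^sup>2 \<ge> 0" by (simp add: abs_square_le_1)
  then show ?thesis using pell[of n x] by (simp add: algebra_simps)
qed

section \<open>The extremal polynomials\<close>

text \<open>This is \<open>U\<^sub>n + \<beta> U\<^bsub>n-2\<^esub>\<close> (see \<open>cheb_G_eq\<close>), written in terms of \<open>T\<^sub>n\<close> and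
\<open>U\<^bsub>n-1\<^esub>\<close>, the unknowns of the Pell equation.\<close>

definition cheb_G :: "real \<Rightarrow> nat \<Rightarrow> real poly" where
  "cheb_G \<beta> n = smult (1 + \<beta>) ([:0, 1:] * cheb_U_aux n) + smult (1 - \<beta>) (cheb_T n)"

text \<open>This is \<open>T\<^bsub>n+1\<^esub> - \<beta> T\<^bsub>n-1\<^esub>\<close>. The polynomial \<open>K = T\<^bsub>n+1\<^esub> + \<beta> T\<^bsub>n-1\<^esub>\<close> that occurs in
the weights is \<open>cheb_J (-\<beta>) n\<close>.\<close>

definition cheb_J :: "real \<Rightarrow> nat \<Rightarrow> real poly" where
  "cheb_J \<beta> n = smult (1 - \<beta>) ([:0, 1:] * cheb_T n) + smult (1 + \<beta>) ([:-1, 0, 1:] * cheb_U_aux n)"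

lemma poly_cheb_G:
  "poly (cheb_G \<beta> n) x = (1 + \<beta>) * x * poly (cheb_U_aux n) x + (1 - \<beta>) * poly (cheb_T n) x"
  by (simp add: cheb_G_def)

lemma poly_cheb_J:
  "poly (cheb_J \<beta> n) x
     = (1 - \<beta>) * x * poly (cheb_T n) x + (1 + \<beta>) * (x\<^sup>2 - 1) * poly (cheb_U_aux n) x"
  by (simp add: cheb_J_def algebra_simps power2_eq_square)

lemma cheb_G_eq:
  assumes "n \<ge> 1"
  shows "poly (cheb_G \<beta> n) x = poly (cheb_U_aux (Suc n)) x + \<beta> * poly (cheb_U_aux (n - 1)) x"
proof -
  obtain k where n: "n = Suc k" using assms by (cases n) auto
  have pred: "poly (cheb_U_aux (n - 1)) x = x * poly (cheb_U_aux n) x - poly (cheb_T n) x"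
    unfolding n cheb_U_aux_Suc cheb_T.simps by (simp add: algebra_simps power2_eq_square)
  show ?thesis
    unfolding poly_cheb_G cheb_U_aux_Suc[of n] pred by (simp add: algebra_simps)
qed

lemma coeff_cheb_G:
  assumes "n \<ge> 1" shows "coeff (cheb_G \<beta> n) n = 2 ^ n" "degree (cheb_G \<beta> n) \<le> n"
proof -
  obtain k where n: "n = Suc k" using assms by (cases n) auto
  show "coeff (cheb_G \<beta> n) n = 2 ^ n"
    unfolding cheb_G_def n by (simp add: cheb_lead_coeff algebra_simps del: cheb_U_aux.simps cheb_T.simps)
  show "degree (cheb_G \<beta> n) \<le> n"
    by (rule degree_le) (auto simp: cheb_G_def coeff_pCons cheb_coeff_eq_0 split: nat.splits)
qed

lemma coeff_cheb_J:
  assumes "n \<ge> 1"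
  shows "coeff (cheb_J \<beta> n) (Suc n) = 2 ^ n" "coeff (cheb_J \<beta> n) n = 0"
    "degree (cheb_J \<beta> n) \<le> Suc n"
proof -
  obtain k where n: "n = Suc k" using assms by (cases n) auto
  show "coeff (cheb_J \<beta> n) (Suc n) = 2 ^ n"
    unfolding cheb_J_def n
    by (simp add: cheb_lead_coeff cheb_coeff_eq_0 algebra_simps del: cheb_U_aux.simps cheb_T.simps)
  show "coeff (cheb_J \<beta> n) n = 0"
    unfolding cheb_J_def n
    by (cases k) (simp_all add: cheb_coeff_eq_0 algebra_simps del: cheb_U_aux.simps cheb_T.simps)
  show "degree (cheb_J \<beta> n) \<le> Suc n"
    by (rule degree_le) (auto simp: cheb_J_def coeff_pCons cheb_coeff_eq_0 split: nat.splits)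
qed

lemma coeff_cheb_T:
  assumes "n \<ge> 1" shows "coeff (cheb_T n) n = 2 ^ (n - 1)" "degree (cheb_T n) \<le> n"
  using assms cheb_lead_coeff(1)[of "n - 1"] cheb_coeff_eq_0(1)[of n]
  by (auto intro!: degree_le)

text \<open>With \<open>x = cos t\<close> this is \<open>(p C c - q S s)\<^sup>2 + (p C s + q S c)\<^sup>2 = p\<^sup>2 C\<^sup>2 + q\<^sup>2 S\<^sup>2\<close> for
\<open>p = 1 - \<beta>\<close> and \<open>q = 1 + \<beta>\<close>, where \<open>C, S\<close> and \<open>c, s\<close> are the cosine and the sine of \<open>n t\<close>
and of \<open>t\<close>; the multiple \<open>4 \<beta> = q\<^sup>2 - p\<^sup>2\<close> of \<open>C\<^sup>2\<close> completes the right-hand side to the constant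
\<open>q\<^sup>2\<close>.\<close>

lemma equioscillation_defect:
  "(poly (cheb_J \<beta> n) x)\<^sup>2 + 4 * \<beta> * (poly (cheb_T n) x)\<^sup>2
     = (1 + \<beta>)\<^sup>2 - (1 - x\<^sup>2) * (poly (cheb_G \<beta> n) x)\<^sup>2"
proof -
  define t v where "t = poly (cheb_T n) x" and "v = poly (cheb_U_aux n) x"
  have p: "t\<^sup>2 = 1 + (x\<^sup>2 - 1) * v\<^sup>2" using pell[of n x] by (simp add: t_def v_def)
  have "((1 - \<beta>) * x * t + (1 + \<beta>) * (x\<^sup>2 - 1) * v)\<^sup>2 + 4 * \<beta> * t\<^sup>2
     - ((1 + \<beta>)\<^sup>2 - (1 - x\<^sup>2) * ((1 + \<beta>) * x * v + (1 - \<beta>) * t)\<^sup>2)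
     = (1 + \<beta>)\<^sup>2 * (t\<^sup>2 - (1 + (x\<^sup>2 - 1) * v\<^sup>2))"
    by (simp add: algebra_simps power2_eq_square)
  then show ?thesis using p by (simp add: poly_cheb_G poly_cheb_J t_def v_def)
qed

lemma equioscillation_bound:
  assumes "\<bar>x\<bar> \<le> 1"
  shows "(poly (cheb_J \<beta> n) x)\<^sup>2 + 4 * \<beta> * (poly (cheb_T n) x)\<^sup>2 \<le> (1 + \<beta>)\<^sup>2"
  using assms by (simp add: equioscillation_defect abs_square_le_1)

section \<open>The support points\<close>

definition node :: "nat \<Rightarrow> nat \<Rightarrow> real" where "node n k = cos (real k * pi / real n)"

lemma node_less:
  assumes "j < k" "k \<le> n" shows "node n k < node n j"
  unfolding node_def using assms
  by (intro cos_monotone_0_pi) (auto simp: divide_simps)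

lemma node_0: "node n 0 = 1"
  by (simp add: node_def)

lemma node_n: "n \<ge> 1 \<Longrightarrow> node n n = -1"
  by (simp add: node_def)

lemma cheb_T_node: "n \<ge> 1 \<Longrightarrow> poly (cheb_T n) (node n k) = (-1) ^ k"
  by (simp add: node_def cheb_T_cos cos_npi)

lemma cheb_U_node:
  assumes "0 < k" "k < n" shows "poly (cheb_U_aux n) (node n k) = 0"
proof -
  have "sin (real k * pi / real n) > 0"
    using assms by (intro sin_gt_zero) (auto simp: divide_simps)
  moreover have "poly (cheb_U_aux n) (node n k) * sin (real k * pi / real n) = 0"
    using assms by (simp add: node_def cheb_U_aux_cos)
  ultimately show ?thesis by simp
qed

text \<open>The roots are the \<open>n + 1\<close> extremal points of \<open>T\<^sub>n\<close>.\<close>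

lemma extremal_nodes:
  assumes n: "n \<ge> 1"
  defines "X \<equiv> {y. poly ([:-1, 0, 1:] * cheb_U_aux n) y = 0}"
  shows "finite X" "card X = Suc n" "X \<subseteq> {-1..1}"
    "degree ([:-1, 0, 1:] * cheb_U_aux n) = Suc n"
    "lead_coeff ([:-1, 0, 1:] * cheb_U_aux n) = 2 ^ (n - 1)"
proof -
  let ?N = "[:-1, 0, 1:] * cheb_U_aux n"
  have c: "coeff ?N (Suc n) = 2 ^ (n - 1)"
    using n cheb_lead_coeff(2)[of "n - 1"] cheb_coeff_eq_0(2)[of n "Suc n"] by (cases n) auto
  have d: "degree ?N \<le> Suc n"
    by (rule degree_le) (auto simp: coeff_pCons cheb_coeff_eq_0 split: nat.splits)
  show D: "degree ?N = Suc n"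
    using d le_degree[of ?N "Suc n"] c by (simp del: mult_pCons_left)
  show "lead_coeff ?N = 2 ^ (n - 1)" unfolding D by (rule c)
  have N0: "?N \<noteq> 0" using D by (metis degree_0 nat.distinct(1))
  show fin: "finite X" unfolding X_def by (rule poly_roots_finite[OF N0])
  have inj: "inj_on (node n) {..n}"
    by (rule linorder_inj_onI') (use node_less in force)
  have sub: "node n ` {..n} \<subseteq> X"
  proof (rule image_subsetI)
    fix k assume "k \<in> {..n}"
    then consider "k = 0" | "k = n" | "0 < k" "k < n" by force
    then show "node n k \<in> X"
      using n by cases (auto simp: X_def node_0 node_n cheb_U_node)
  qed
  have "card X \<le> Suc n"
    using card_poly_roots_bound[OF N0] D by (simp add: X_def)
  moreover have "card (node n ` {..n}) = Suc n" using inj by (simp add: card_image)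
  ultimately have X: "node n ` {..n} = X"
    using fin sub by (intro card_seteq) auto
  then show "card X = Suc n" using \<open>card (node n ` {..n}) = Suc n\<close> by simp
  show "X \<subseteq> {-1..1}" unfolding X[symmetric] by (auto simp: node_def)
qed

text \<open>At the extremal points of \<open>T\<^sub>n\<close> the polynomial \<open>G\<close> has the sign of \<open>T\<^sub>n\<close>, which alternates. So it
has a root between any two neighbours, and together with the end points these \<open>n\<close> roots exhaust the
degree \<open>n + 2\<close>.\<close>

lemma interlacing_nodes:
  assumes n: "n \<ge> 1" and \<beta>: "0 \<le> \<beta>" "\<beta> < 1"
  defines "X \<equiv> {y. poly ([:-1, 0, 1:] * cheb_G \<beta> n) y = 0}"
  shows "finite X" "card X = Suc (Suc n)" "X \<subseteq> {-1..1}"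
    "degree ([:-1, 0, 1:] * cheb_G \<beta> n) = Suc (Suc n)"
    "lead_coeff ([:-1, 0, 1:] * cheb_G \<beta> n) = 2 ^ n"
proof -
  let ?N = "[:-1, 0, 1:] * cheb_G \<beta> n"
  have c: "coeff ?N (Suc (Suc n)) = 2 ^ n"
    using coeff_cheb_G[OF n, of \<beta>] coeff_eq_0[of "cheb_G \<beta> n" "Suc (Suc n)"] by simp
  have d: "degree ?N \<le> Suc (Suc n)"
    using degree_mult_le[of "[:-1, 0, 1:]" "cheb_G \<beta> n"] coeff_cheb_G(2)[OF n, of \<beta>] by simp
  show D: "degree ?N = Suc (Suc n)"
    using d le_degree[of ?N "Suc (Suc n)"] c by (simp del: mult_pCons_left)
  show "lead_coeff ?N = 2 ^ n" unfolding D by (rule c)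
  have N0: "?N \<noteq> 0" using D by (metis degree_0 nat.distinct(1))
  show fin: "finite X" unfolding X_def by (rule poly_roots_finite[OF N0])
  have sgn: "(-1) ^ k * poly (cheb_G \<beta> n) (node n k) > 0" if k: "k \<le> n" for k
  proof (cases "0 < k \<and> k < n")
    case True
    then have "(-1) ^ k * poly (cheb_G \<beta> n) (node n k) = (1 - \<beta>) * ((-1) ^ k * (-1) ^ k)"
      using n by (simp add: poly_cheb_G cheb_U_node cheb_T_node)
    then show ?thesis using \<beta> by (simp flip: power_mult_distrib)
  next
    case False
    then have "(node n k)\<^sup>2 = 1" using k node_0 node_n[OF n] by (cases "k = 0") auto
    from cheb_at_pm1(1)[OF this, of n]
    have "poly (cheb_G \<beta> n) (node n k) = (-1) ^ k * ((1 + \<beta>) * real n + (1 - \<beta>))"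
      using n by (simp add: poly_cheb_G cheb_T_node algebra_simps)
    then show ?thesis using \<beta> n by (simp add: mult.assoc[symmetric] add_nonneg_pos)
  qed
  have "\<exists>r. node n (Suc k) < r \<and> r < node n k \<and> poly (cheb_G \<beta> n) r = 0" if k: "k < n" for k
  proof -
    have "0 < ((-1) ^ k * poly (cheb_G \<beta> n) (node n k))
        * ((-1) ^ Suc k * poly (cheb_G \<beta> n) (node n (Suc k)))"
      using k by (intro mult_pos_pos sgn) auto
    also have "\<dots> = - (poly (cheb_G \<beta> n) (node n (Suc k)) * poly (cheb_G \<beta> n) (node n k))"
      by (simp add: algebra_simps flip: power_mult_distrib)
    finally have "poly (cheb_G \<beta> n) (node n (Suc k)) * poly (cheb_G \<beta> n) (node n k) < 0" by simp
    then show ?thesis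
      using poly_IVT[of "node n (Suc k)" "node n k" "cheb_G \<beta> n"] node_less[of k "Suc k" n] k by auto
  qed
  then obtain r where r: "\<And>k. k < n \<Longrightarrow> node n (Suc k) < r k"
    "\<And>k. k < n \<Longrightarrow> r k < node n k" "\<And>k. k < n \<Longrightarrow> poly (cheb_G \<beta> n) (r k) = 0"
    by metis
  have node_le: "node n k \<le> node n j" if "j \<le> k" "k \<le> n" for j k
    using node_less[of j k n] that by (cases "j = k") auto
  have inj: "inj_on r {..<n}"
  proof (rule linorder_inj_onI')
    fix j k assume jk: "j \<in> {..<n}" "k \<in> {..<n}" "j < k"
    then have "r k < node n k" "node n k \<le> node n (Suc j)" "node n (Suc j) < r j"
      by (auto intro!: r node_le)
    then show "r j \<noteq> r k" by simp
  qed
  have r1: "-1 < r k \<and> r k < 1" if "k < n" for k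
    using r(1,2)[OF that] node_le[of "Suc k" n] node_le[of 0 k] that node_0[of n] node_n[OF n] by auto
  define Y where "Y = insert (-1) (insert 1 (r ` {..<n}))"
  have "card Y = Suc (Suc n)"
  proof -
    have "1 \<notin> r ` {..<n}" "-1 \<notin> insert 1 (r ` {..<n})" using r1 by force+
    then show ?thesis using inj by (simp add: Y_def card_image)
  qed
  moreover have "Y \<subseteq> X" unfolding X_def Y_def using r(3) by auto
  moreover have "card X \<le> Suc (Suc n)"
    using card_poly_roots_bound[OF N0] D by (simp add: X_def)
  ultimately have X: "Y = X" using fin by (intro card_seteq) auto
  then show "card X = Suc (Suc n)" using \<open>card Y = Suc (Suc n)\<close> by simp
  show "X \<subseteq> {-1..1}" unfolding X[symmetric] Y_def using r1 by (auto simp: less_imp_le)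
qed

section \<open>Weights and moments of the designs\<close>

lemma poly_pderiv_nodal:
  fixes p :: "real poly"
  shows "poly (pderiv ([:-1, 0, 1:] * p)) x = 2 * x * poly p x + (x\<^sup>2 - 1) * poly (pderiv p) x"
proof -
  have "poly (pderiv ([:-1, 0, 1:] * p)) x
     = poly [:-1, 0, 1:] x * poly (pderiv p) x + poly p x * poly (pderiv [:-1, 0, 1:]) x"
    by (simp only: pderiv_mult poly_add poly_mult)
  also have "\<dots> = 2 * x * poly p x + (x\<^sup>2 - 1) * poly (pderiv p) x"
    by (simp add: pderiv_pCons algebra_simps power2_eq_square)
  finally show ?thesis .
qed

lemma pderiv_cheb_G:
  "(x\<^sup>2 - 1) * poly (pderiv (cheb_G \<beta> n)) x
     = real n * poly (cheb_J (-\<beta>) n) x - (1 + \<beta>) * poly (cheb_U_aux n) x"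
proof -
  let ?u = "poly (cheb_U_aux n) x" and ?t = "poly (cheb_T n) x"
  have der: "poly (pderiv (cheb_G \<beta> n)) x
     = (1 + \<beta>) * (?u + x * poly (pderiv (cheb_U_aux n)) x) + (1 - \<beta>) * real n * ?u"
    unfolding cheb_G_def by (simp only: pderiv_add pderiv_smult pderiv_mult poly_add poly_smult
      poly_mult cheb_derivs(1)) (simp add: pderiv_pCons algebra_simps)
  have "(x\<^sup>2 - 1) * poly (pderiv (cheb_G \<beta> n)) x
     = (1 + \<beta>) * ((x\<^sup>2 - 1) * ?u + x * ((x\<^sup>2 - 1) * poly (pderiv (cheb_U_aux n)) x))
       + (1 - \<beta>) * real n * (x\<^sup>2 - 1) * ?u"
    unfolding der by (simp add: algebra_simps)
  also have "\<dots> = real n * poly (cheb_J (-\<beta>) n) x - (1 + \<beta>) * ?u"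
    unfolding cheb_derivs(2) poly_cheb_J by (simp add: algebra_simps power2_eq_square)
  finally show ?thesis .
qed

text \<open>Modulo the equation of the nodes both products reduce, by the Pell equation, to polynomials of
very low degree. This is why the quadrature rule is exact far enough.\<close>

lemma node_products:
  assumes "(x\<^sup>2 - 1) * poly (cheb_G \<beta> n) x = 0"
  shows "poly (cheb_J (-\<beta>) n) x * poly (cheb_T n) x = (1 + \<beta>) * x"
    and "poly (cheb_J (-\<beta>) n) x * poly (cheb_J \<beta> n) x = 1 - \<beta>\<^sup>2"
proof -
  define t v where "t = poly (cheb_T n) x" and "v = poly (cheb_U_aux n) x"
  have p: "t\<^sup>2 - (x\<^sup>2 - 1) * v\<^sup>2 = 1" using pell[of n x] by (simp add: t_def v_def)
  have K: "poly (cheb_J (-\<beta>) n) x = (1 + \<beta>) * x * t + (1 - \<beta>) * (x\<^sup>2 - 1) * v"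
    and J: "poly (cheb_J \<beta> n) x = (1 - \<beta>) * x * t + (1 + \<beta>) * (x\<^sup>2 - 1) * v"
    by (simp_all add: poly_cheb_J t_def v_def)
  have g: "(x\<^sup>2 - 1) * ((1 + \<beta>) * x * v + (1 - \<beta>) * t) = 0"
    using assms by (simp add: poly_cheb_G t_def v_def)
  have "((1 + \<beta>) * x * t + (1 - \<beta>) * (x\<^sup>2 - 1) * v) * t
     = (1 + \<beta>) * x * (t\<^sup>2 - (x\<^sup>2 - 1) * v\<^sup>2)
       + v * ((x\<^sup>2 - 1) * ((1 + \<beta>) * x * v + (1 - \<beta>) * t))"
    by (simp add: algebra_simps power2_eq_square)
  then show "poly (cheb_J (-\<beta>) n) x * poly (cheb_T n) x = (1 + \<beta>) * x"
    unfolding K t_def[symmetric] g p by simp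
  have "((1 + \<beta>) * x * t + (1 - \<beta>) * (x\<^sup>2 - 1) * v) * ((1 - \<beta>) * x * t + (1 + \<beta>) * (x\<^sup>2 - 1) * v)
     = (1 - \<beta>\<^sup>2) * (t\<^sup>2 - (x\<^sup>2 - 1) * v\<^sup>2)
       + ((1 + \<beta>) * x * v + (1 - \<beta>) * t) * (x\<^sup>2 - 1) * ((1 + \<beta>) * t + (1 - \<beta>) * x * v)"
    by (simp add: algebra_simps power2_eq_square)
  also have "((1 + \<beta>) * x * v + (1 - \<beta>) * t) * (x\<^sup>2 - 1) = 0"
    using g by (simp only: mult.commute)
  finally show "poly (cheb_J (-\<beta>) n) x * poly (cheb_J \<beta> n) x = 1 - \<beta>\<^sup>2"
    unfolding K J p by simp
qed

lemma cheb_U_int: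
  "n \<ge> 1 \<Longrightarrow> cheb_U (int (Suc n) - 3) = cheb_U_aux (n - 1)"
  "cheb_U (int (Suc n) - 2) = cheb_U_aux n"
  "cheb_U (int (Suc n) - 1) = cheb_U_aux (Suc n)"
  "cheb_U (int (Suc n)) = cheb_U_aux (Suc (Suc n))"
  by (auto simp: cheb_U_def nat_add_distrib nat_diff_distrib simp del: cheb_U_aux.simps
      intro!: arg_cong[of _ _ cheb_U_aux])

text \<open>At an interior node \<open>G = 0\<close> turns the denominator \<open>U\<^sub>m + \<beta> U\<^bsub>m-2\<^esub>\<close> of the given weight into \<open>K\<close>,
and \<open>N'\<close> into \<open>n K - (1 + \<beta>) U\<^bsub>m-2\<^esub>\<close>; the weight is then \<open>K / N'\<close>. It is positive because
\<open>(1 + \<beta>) U\<^bsub>m-2\<^esub> / K\<close> is the negative of the Poisson kernel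
\<open>(1 - \<beta>\<^sup>2) / ((1 - \<beta>)\<^sup>2 + 4 \<beta> y\<^sup>2)\<close>.\<close>

lemma xi_mass_interlacing:
  assumes n: "n \<ge> 1" and \<beta>: "0 \<le> \<beta>" "\<beta> < 1" and a: "a > 0"
  shows "poly ([:-1, 0, 1:] * cheb_G \<beta> n) y \<noteq> 0 \<Longrightarrow> xi_mass (Suc n) a \<beta> (a * y) = 0"
    and "poly ([:-1, 0, 1:] * cheb_G \<beta> n) y = 0 \<Longrightarrow> xi_mass (Suc n) a \<beta> (a * y) =
      poly (cheb_J (-\<beta>) n) y / poly (pderiv ([:-1, 0, 1:] * cheb_G \<beta> n)) y"
    and "xi_mass (Suc n) a \<beta> (a * y) \<ge> 0"
proof -
  let ?N = "[:-1, 0, 1:] * cheb_G \<beta> n"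
  define t v where "t = poly (cheb_T n) y" and "v = poly (cheb_U_aux n) y"
  define K where "K = poly (cheb_J (-\<beta>) n) y"
  have N: "poly ?N y = (y\<^sup>2 - 1) * poly (cheb_G \<beta> n) y"
    by (simp add: algebra_simps power2_eq_square)
  have "xi_poly (Suc n) a \<beta> (a * y) = a\<^sup>2 * poly ?N y"
    using a unfolding xi_poly_def cheb_U_int(1)[OF n] cheb_U_int(3) N cheb_G_eq[OF n]
    by (simp add: algebra_simps power2_eq_square del: cheb_U_aux.simps)
  then have xi0: "xi_poly (Suc n) a \<beta> (a * y) = 0 \<longleftrightarrow> poly ?N y = 0" using a by simp
  have y1: "a * y = -a \<or> a * y = a \<longleftrightarrow> y\<^sup>2 = 1"
    using a mult_cancel_left[of a y "-1"] mult_cancel_left[of a y 1]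
    by (simp add: power2_eq_1_iff disj_commute)
  show "poly ?N y \<noteq> 0 \<Longrightarrow> xi_mass (Suc n) a \<beta> (a * y) = 0"
    using \<beta> xi0 by (simp add: xi_mass_def del: mult_pCons_left)
  have main: "xi_mass (Suc n) a \<beta> (a * y) = K / poly (pderiv ?N) y
      \<and> xi_mass (Suc n) a \<beta> (a * y) \<ge> 0" if N0: "poly ?N y = 0"
  proof (cases "y\<^sup>2 = 1")
    case True
    note pm = cheb_at_pm1[OF True, of n, folded t_def v_def]
    define M where "M = real (Suc n) + \<beta> * (real (Suc n) - 2)"
    have m0: "M > 0" unfolding M_def using n \<beta> by (intro add_pos_nonneg) auto
    have G: "poly (cheb_G \<beta> n) y = t * M"
    proof -
      have "poly (cheb_G \<beta> n) y = (1 + \<beta>) * (y * v) + (1 - \<beta>) * t"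
        by (simp add: poly_cheb_G t_def v_def)
      then show ?thesis unfolding pm(1) M_def by (simp add: algebra_simps)
    qed
    have w: "xi_mass (Suc n) a \<beta> (a * y) = (1 + \<beta>) / (2 * M)"
      unfolding xi_mass_def M_def using \<beta> xi0 N0 y1 True by (simp del: mult_pCons_left of_nat_Suc)
    have 1: "K = (y * t) * (1 + \<beta>)" using True by (simp add: K_def poly_cheb_J t_def)
    have 2: "poly (pderiv ?N) y = (y * t) * (2 * M)"
      unfolding poly_pderiv_nodal G using True by simp
    have "(y * t)\<^sup>2 = 1" using True pm by (simp add: power_mult_distrib)
    then have "y * t \<noteq> 0" by auto
    then have "K / poly (pderiv ?N) y = (1 + \<beta>) / (2 * M)"
      unfolding 1 2 by (rule mult_divide_mult_cancel_left)
    then show ?thesis using w m0 \<beta> by simp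
  next
    case False
    then have G: "poly (cheb_G \<beta> n) y = 0" using N N0 by simp
    then have g: "(1 + \<beta>) * y * v + (1 - \<beta>) * t = 0" by (simp add: poly_cheb_G t_def v_def)
    have Keq: "K = (1 + \<beta>) * y * t + (1 - \<beta>) * (y\<^sup>2 - 1) * v"
      by (simp add: K_def poly_cheb_J t_def v_def)
    have v0: "v \<noteq> 0"
    proof
      assume "v = 0"
      then have "t = 0" using g \<beta> by simp
      then show False using pell[of n y] \<open>v = 0\<close> by (simp add: t_def v_def)
    qed
    have "(1 - \<beta>) * K = (1 + \<beta>) * y * ((1 + \<beta>) * y * v + (1 - \<beta>) * t)
        - v * ((1 - \<beta>)\<^sup>2 + 4 * \<beta> * y\<^sup>2)"
      by (simp add: Keq algebra_simps power2_eq_square)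
    then have Kv: "(1 - \<beta>) * K = - v * ((1 - \<beta>)\<^sup>2 + 4 * \<beta> * y\<^sup>2)" using g by simp
    have pos: "(1 - \<beta>)\<^sup>2 + 4 * \<beta> * y\<^sup>2 > 0" using \<beta> by (intro add_pos_nonneg) auto
    have K0: "K \<noteq> 0" using Kv v0 pos \<beta> by auto
    \<comment> \<open>\<open>Kv\<close> shows that \<open>K\<close> and \<open>v\<close> have opposite signs\<close>
    have "v / K \<le> 0"
    proof -
      have "(1 - \<beta>) * (v * K) = - (v\<^sup>2 * ((1 - \<beta>)\<^sup>2 + 4 * \<beta> * y\<^sup>2))"
        using Kv by (simp add: power2_eq_square mult.left_commute)
      also have "\<dots> \<le> 0" using pos by simp
      finally have "v * K \<le> 0" using \<beta> by (simp add: mult_le_0_iff)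
      then show ?thesis by (auto simp: divide_le_0_iff mult_le_0_iff)
    qed
    then have "(1 + \<beta>) * (v / K) \<le> 0" using \<beta> by (intro mult_nonneg_nonpos) auto
    then have wpos: "real n - (1 + \<beta>) * v / K > 0" using n by simp
    have "poly (cheb_U_aux (Suc (Suc n))) y = 2 * y * (y * v + t) - v"
      by (simp only: cheb_U_aux.simps cheb_U_aux_Suc[of n]) (simp add: t_def v_def)
    \<comment> \<open>the difference of the two sides is \<open>y G(y)\<close>\<close>
    then have den: "poly (cheb_U_aux (Suc (Suc n))) y + \<beta> * v = K"
    proof -
      have "2 * y * (y * v + t) - v + \<beta> * v = K + y * ((1 + \<beta>) * y * v + (1 - \<beta>) * t)"
        by (simp add: Keq algebra_simps power2_eq_square)
      then show ?thesis unfolding \<open>poly (cheb_U_aux (Suc (Suc n))) y = _\<close> g by simp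
    qed
    have w: "xi_mass (Suc n) a \<beta> (a * y) = inverse (real n - (1 + \<beta>) * v / K)"
      unfolding xi_mass_def cheb_U_int using \<beta> xi0 N0 y1 False a den
      by (simp del: mult_pCons_left cheb_U_aux.simps add: v_def)
    have "poly (pderiv ?N) y = real n * K - (1 + \<beta>) * v"
      unfolding poly_pderiv_nodal pderiv_cheb_G G by (simp add: K_def v_def)
    also have "\<dots> = K * (real n - (1 + \<beta>) * v / K)" using K0 by (simp add: field_simps)
    finally have "K / poly (pderiv ?N) y = inverse (real n - (1 + \<beta>) * v / K)"
      using K0 by (simp add: inverse_eq_divide)
    then show ?thesis using w wpos by simp
  qed
  show "poly ?N y = 0 \<Longrightarrow> xi_mass (Suc n) a \<beta> (a * y) = poly (cheb_J (-\<beta>) n) y / poly (pderiv ?N) y"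
    using main by (simp add: K_def)
  show "xi_mass (Suc n) a \<beta> (a * y) \<ge> 0"
    using main \<open>poly ?N y \<noteq> 0 \<Longrightarrow> xi_mass (Suc n) a \<beta> (a * y) = 0\<close> by (cases "poly ?N y = 0") auto
qed

lemma xi_mass_extremal:
  assumes n: "n \<ge> 1" and a: "a > 0"
  shows "poly ([:-1, 0, 1:] * cheb_U_aux n) y \<noteq> 0 \<Longrightarrow> xi_mass (Suc n) a 1 (a * y) = 0"
    and "poly ([:-1, 0, 1:] * cheb_U_aux n) y = 0 \<Longrightarrow> xi_mass (Suc n) a 1 (a * y) =
      poly (cheb_T n) y / poly (pderiv ([:-1, 0, 1:] * cheb_U_aux n)) y"
    and "xi_mass (Suc n) a 1 (a * y) \<ge> 0"
proof -
  let ?N = "[:-1, 0, 1:] * cheb_U_aux n"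
  have N: "poly ?N y = (y\<^sup>2 - 1) * poly (cheb_U_aux n) y"
    by (simp add: algebra_simps power2_eq_square)
  have y1: "a * y = -a \<or> a * y = a \<longleftrightarrow> y\<^sup>2 = 1"
    using a mult_cancel_left[of a y "-1"] mult_cancel_left[of a y 1]
    by (simp add: power2_eq_1_iff disj_commute)
  have w: "xi_mass (Suc n) a 1 (a * y) = (if y\<^sup>2 = 1 then 1 / (2 * real n)
     else if poly (cheb_U_aux n) y = 0 then 1 / real n else 0)"
    unfolding xi_mass_def cheb_U_int y1 using a by simp
  show "xi_mass (Suc n) a 1 (a * y) \<ge> 0" using w by simp
  show "poly ?N y \<noteq> 0 \<Longrightarrow> xi_mass (Suc n) a 1 (a * y) = 0" using N w by auto
  have der: "poly (pderiv ?N) y = y * poly (cheb_U_aux n) y + real n * poly (cheb_T n) y"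
    unfolding poly_pderiv_nodal cheb_derivs by (simp add: algebra_simps)
  assume N0: "poly ?N y = 0"
  show "xi_mass (Suc n) a 1 (a * y) = poly (cheb_T n) y / poly (pderiv ?N) y"
  proof (cases "y\<^sup>2 = 1")
    case True
    show ?thesis unfolding der w using cheb_at_pm1[OF True, of n] True n by auto
  next
    case False
    then have "poly (cheb_U_aux n) y = 0" using N N0 by simp
    then show ?thesis unfolding der w using pell[of n y] False n by auto
  qed
qed

text \<open>All that is needed about the mass function of the design. The case \<open>\<beta> = 1\<close> is separate: there \<open>G\<close>
acquires the additional root \<open>0\<close>, and the design lives on the roots of \<open>(x\<^sup>2 - 1) U\<^bsub>n-1\<^esub>\<close>, at which
\<open>J\<close> vanishes and \<open>T\<^sub>n\<close> is \<open>1\<close> or \<open>-1\<close>.\<close>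

lemma optimal_moments:
  assumes n: "n \<ge> 1" and \<beta>: "0 \<le> \<beta>" "\<beta> \<le> 1" and a: "a > 0"
  obtains X :: "real set" where
    "finite X" "X \<subseteq> {-1..1}"
    "\<And>y. y \<notin> X \<Longrightarrow> xi_mass (Suc n) a \<beta> (a * y) = 0"
    "\<And>y. xi_mass (Suc n) a \<beta> (a * y) \<ge> 0"
    "(\<Sum>y\<in>X. xi_mass (Suc n) a \<beta> (a * y)) = 1"
    "\<And>q. degree q < n \<Longrightarrow>
       (\<Sum>y\<in>X. xi_mass (Suc n) a \<beta> (a * y) * (poly (cheb_T n) y * poly q y)) = 0"
    "\<And>q. degree q < n \<Longrightarrow>
       (\<Sum>y\<in>X. xi_mass (Suc n) a \<beta> (a * y) * (poly (cheb_J \<beta> n) y * poly q y)) = 0"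
    "(\<Sum>y\<in>X. xi_mass (Suc n) a \<beta> (a * y) * (poly (cheb_T n) y)\<^sup>2) = (1 + \<beta>) / 2"
    "(\<Sum>y\<in>X. xi_mass (Suc n) a \<beta> (a * y) * (poly (cheb_J \<beta> n) y * poly (cheb_T n) y)) = 0"
    "(\<Sum>y\<in>X. xi_mass (Suc n) a \<beta> (a * y) * (poly (cheb_J \<beta> n) y)\<^sup>2) = 1 - \<beta>\<^sup>2"
proof (cases "\<beta> = 1")
  case False
  then have \<beta>1: "\<beta> < 1" using \<beta> by simp
  let ?N = "[:-1, 0, 1:] * cheb_G \<beta> n"
  define X where "X = {y. poly ?N y = 0}"
  note X = interlacing_nodes[OF n \<beta>(1) \<beta>1, folded X_def]
  define w where "w y = xi_mass (Suc n) a \<beta> (a * y)" for y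
  have wX: "w y = poly (cheb_J (-\<beta>) n) y / poly (pderiv ?N) y" if "y \<in> X" for y
    using xi_mass_interlacing(2)[OF n \<beta>(1) \<beta>1 a] that unfolding w_def X_def by blast
  have N0: "\<And>y. y \<in> X \<Longrightarrow> poly ?N y = 0" by (simp add: X_def)
  have quad: "(\<Sum>y\<in>X. poly f y / poly (pderiv ?N) y) = coeff f (Suc n) / 2 ^ n"
    if "degree f \<le> Suc n" for f
    using nodal_derivative_quadrature(1)[OF X(1) _ N0, of f] X(2,4,5) that by simp
  have prods: "poly (cheb_J (-\<beta>) n) y * poly (cheb_T n) y = (1 + \<beta>) * y"
    "poly (cheb_J (-\<beta>) n) y * poly (cheb_J \<beta> n) y = 1 - \<beta>\<^sup>2" if "y \<in> X" for y
  proof -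
    have "(y\<^sup>2 - 1) * poly (cheb_G \<beta> n) y = 0"
      using N0[OF that] by (simp add: algebra_simps power2_eq_square)
    then show "poly (cheb_J (-\<beta>) n) y * poly (cheb_T n) y = (1 + \<beta>) * y"
      "poly (cheb_J (-\<beta>) n) y * poly (cheb_J \<beta> n) y = 1 - \<beta>\<^sup>2"
      using node_products[of y \<beta> n] by auto
  qed
  have ST: "(\<Sum>y\<in>X. w y * (poly (cheb_T n) y * poly q y)) = (1 + \<beta>) * (coeff q n / 2 ^ n)"
    if "degree q \<le> n" for q
  proof -
    have "(\<Sum>y\<in>X. w y * (poly (cheb_T n) y * poly q y))
       = (\<Sum>y\<in>X. (1 + \<beta>) * (poly ([:0, 1:] * q) y / poly (pderiv ?N) y))"
      by (intro sum.cong) (simp_all add: wX prods(1) mult.assoc[symmetric])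
    also have "\<dots> = (1 + \<beta>) * (coeff ([:0, 1:] * q) (Suc n) / 2 ^ n)"
      unfolding sum_distrib_left[symmetric]
      by (subst quad) (use that in \<open>auto intro: order.trans[OF degree_pCons_le]\<close>)
    finally show ?thesis by simp
  qed
  have SJ: "(\<Sum>y\<in>X. w y * (poly (cheb_J \<beta> n) y * poly q y))
      = (1 - \<beta>\<^sup>2) * (coeff q (Suc n) / 2 ^ n)"
    if "degree q \<le> Suc n" for q
  proof -
    have "(\<Sum>y\<in>X. w y * (poly (cheb_J \<beta> n) y * poly q y))
       = (\<Sum>y\<in>X. (1 - \<beta>\<^sup>2) * (poly q y / poly (pderiv ?N) y))"
      by (intro sum.cong) (simp_all add: wX prods(2) mult.assoc[symmetric])
    then show ?thesis unfolding sum_distrib_left[symmetric] quad[OF that] .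
  qed
  show thesis
  proof (rule that[of X, folded w_def])
    show "finite X" "X \<subseteq> {-1..1}" by (fact X)+
    show "w y = 0" if "y \<notin> X" for y
      using xi_mass_interlacing(1)[OF n \<beta>(1) \<beta>1 a] that unfolding w_def X_def by blast
    show "w y \<ge> 0" for y using xi_mass_interlacing(3)[OF n \<beta>(1) \<beta>1 a] by (simp add: w_def)
    have "(\<Sum>y\<in>X. w y) = (\<Sum>y\<in>X. poly (cheb_J (-\<beta>) n) y / poly (pderiv ?N) y)"
      by (intro sum.cong) (simp_all add: wX)
    then show "(\<Sum>y\<in>X. w y) = 1"
      using quad[of "cheb_J (-\<beta>) n"] coeff_cheb_J[OF n, of "-\<beta>"] by simp
    show "(\<Sum>y\<in>X. w y * (poly (cheb_T n) y * poly q y)) = 0" if "degree q < n" for q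
      using ST[of q] that by (simp add: coeff_eq_0)
    show "(\<Sum>y\<in>X. w y * (poly (cheb_J \<beta> n) y * poly q y)) = 0" if "degree q < n" for q
      using SJ[of q] that by (simp add: coeff_eq_0)
    have "(2::real) ^ n = 2 * 2 ^ (n - 1)" using n by (cases n) auto
    then show "(\<Sum>y\<in>X. w y * (poly (cheb_T n) y)\<^sup>2) = (1 + \<beta>) / 2"
      using ST[of "cheb_T n"] coeff_cheb_T[OF n] by (simp add: power2_eq_square)
    show "(\<Sum>y\<in>X. w y * (poly (cheb_J \<beta> n) y * poly (cheb_T n) y)) = 0"
      using SJ[of "cheb_T n"] coeff_cheb_T[OF n] by (simp add: cheb_coeff_eq_0)
    show "(\<Sum>y\<in>X. w y * (poly (cheb_J \<beta> n) y)\<^sup>2) = 1 - \<beta>\<^sup>2"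
      using SJ[of "cheb_J \<beta> n"] coeff_cheb_J[OF n, of \<beta>] by (simp add: power2_eq_square)
  qed
next
  case True
  let ?N = "[:-1, 0, 1:] * cheb_U_aux n"
  define X where "X = {y. poly ?N y = 0}"
  note X = extremal_nodes[OF n, folded X_def]
  define w where "w y = xi_mass (Suc n) a \<beta> (a * y)" for y
  have wX: "w y = poly (cheb_T n) y / poly (pderiv ?N) y" if "y \<in> X" for y
    using xi_mass_extremal(2)[OF n a] that True unfolding w_def X_def by blast
  have N0: "\<And>y. y \<in> X \<Longrightarrow> poly ?N y = 0" by (simp add: X_def)
  have quad: "(\<Sum>y\<in>X. poly f y / poly (pderiv ?N) y) = coeff f n / 2 ^ (n - 1)"
    if "degree f \<le> n" for f
    using nodal_derivative_quadrature(1)[OF X(1) _ N0, of f] X(2,4,5) that by simp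
  have node: "(y\<^sup>2 - 1) * poly (cheb_U_aux n) y = 0" if "y \<in> X" for y
    using N0[OF that] by (simp add: algebra_simps power2_eq_square)
  have T2: "(poly (cheb_T n) y)\<^sup>2 = 1" if "y \<in> X" for y
    using pell[of n y] node[OF that] by (auto simp: power2_eq_square)
  have J0: "poly (cheb_J \<beta> n) y = 0" if "y \<in> X" for y
    using node[OF that] True by (auto simp: poly_cheb_J)
  have sum1: "(\<Sum>y\<in>X. w y) = 1"
  proof -
    have "(\<Sum>y\<in>X. w y) = (\<Sum>y\<in>X. poly (cheb_T n) y / poly (pderiv ?N) y)"
      by (intro sum.cong) (simp_all add: wX)
    then show ?thesis using quad[of "cheb_T n"] coeff_cheb_T[OF n] by simp
  qed
  show thesis
  proof (rule that[of X, folded w_def])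
    show "finite X" "X \<subseteq> {-1..1}" by (fact X)+
    show "w y = 0" if "y \<notin> X" for y
      using xi_mass_extremal(1)[OF n a] that True unfolding w_def X_def by blast
    show "w y \<ge> 0" for y using xi_mass_extremal(3)[OF n a] True by (simp add: w_def)
    show "(\<Sum>y\<in>X. w y) = 1" by (fact sum1)
    show "(\<Sum>y\<in>X. w y * (poly (cheb_T n) y * poly q y)) = 0" if "degree q < n" for q
    proof -
      have "(\<Sum>y\<in>X. w y * (poly (cheb_T n) y * poly q y)) = (\<Sum>y\<in>X. poly q y / poly (pderiv ?N) y)"
      proof (intro sum.cong refl)
        fix y assume y: "y \<in> X"
        have "w y * (poly (cheb_T n) y * poly q y)
            = (poly (cheb_T n) y)\<^sup>2 * poly q y / poly (pderiv ?N) y"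
          unfolding wX[OF y] by (simp only: power2_eq_square times_divide_eq_left mult.assoc)
        then show "w y * (poly (cheb_T n) y * poly q y) = poly q y / poly (pderiv ?N) y"
          using T2[OF y] by simp
      qed
      then show ?thesis using quad[of q] that by (simp add: coeff_eq_0)
    qed
    show "(\<Sum>y\<in>X. w y * (poly (cheb_T n) y)\<^sup>2) = (1 + \<beta>) / 2"
      using sum1 T2 True by simp
  qed (use J0 True in simp_all)
qed

section \<open>The criterion as a least squares problem\<close>

abbreviation E :: "real pmf \<Rightarrow> (real \<Rightarrow> real) \<Rightarrow> real" where
  "E \<xi> f \<equiv> measure_pmf.expectation \<xi> f"

text \<open>Up to the sign these are the functions under the square in \<open>Tbar\<close>.\<close>

definition gap_polys :: "nat \<Rightarrow> real \<Rightarrow> real poly set" where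
  "gap_polys m b = {r. degree r \<le> m \<and> coeff r m = 1 \<and> coeff r (m - 1) = b}"

lemma poly_gap_polys:
  assumes "m \<ge> 2" "r \<in> gap_polys m b"
  shows "poly r x = x ^ m + b * x ^ (m - 1) + (\<Sum>i\<le>m - 2. coeff r i * x ^ i)"
proof -
  obtain k where m: "m = Suc (Suc k)" using assms(1) by (metis Suc_le_D numeral_2_eq_2 Suc_le_mono)
  have "poly r x = (\<Sum>i\<le>m. coeff r i * x ^ i)"
    unfolding poly_altdef using assms(2)
    by (intro sum.mono_neutral_left) (auto simp: gap_polys_def coeff_eq_0)
  then show ?thesis using assms(2) by (simp add: m gap_polys_def)
qed

lemma gap_polys_of_coeffs:
  assumes "m \<ge> 2"
  obtains r where "r \<in> gap_polys m b"
    "\<And>x. poly r x = x ^ m + b * x ^ (m - 1) + (\<Sum>i\<le>m - 2. q i * x ^ i)"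
proof -
  define p where "p = (\<Sum>i\<le>m - 2. monom (q i) i)"
  have p: "coeff p i = 0" if "i > m - 2" for i
    using that by (simp add: p_def coeff_sum)
  have "monom 1 m + monom b (m - 1) + p \<in> gap_polys m b"
    using assms p unfolding gap_polys_def by (auto intro!: degree_le)
  moreover have "poly (monom 1 m + monom b (m - 1) + p) x
      = x ^ m + b * x ^ (m - 1) + (\<Sum>i\<le>m - 2. q i * x ^ i)" for x
    by (simp add: p_def poly_monom poly_sum)
  ultimately show thesis by (rule that)
qed

lemma gap_polys_diff:
  assumes "m \<ge> 2" "r \<in> gap_polys m b" "r' \<in> gap_polys m b"
  shows "degree (r - r') \<le> m - 2"
proof (rule degree_le, intro allI impI)
  fix i assume "m - 2 < i"
  then consider "i = m - 1" | "i = m" | "i > m" by linarith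
  then show "coeff (r - r') i = 0"
    using assms by cases (auto simp: gap_polys_def coeff_eq_0)
qed

lemma gap_polys_add:
  assumes "m \<ge> 2" "r \<in> gap_polys m b" "degree d \<le> m - 2"
  shows "r + d \<in> gap_polys m b"
  using assms unfolding gap_polys_def by (auto simp: coeff_eq_0 intro!: degree_add_le)

lemma Tbar_eq_INF:
  assumes "m \<ge> 2"
  shows "Tbar m \<xi> b = (INF r\<in>gap_polys m b. E \<xi> (\<lambda>x. (poly r x)\<^sup>2))"
proof -
  let ?F = "\<lambda>q. E \<xi> (\<lambda>x. ((\<Sum>i\<le>m - 2. q i * x ^ i) - b * x ^ (m - 1) - x ^ m)\<^sup>2)"
  have "range ?F = (\<lambda>r. E \<xi> (\<lambda>x. (poly r x)\<^sup>2)) ` gap_polys m b"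
  proof (intro equalityI subsetI)
    fix y assume "y \<in> range ?F"
    then obtain q where y: "y = ?F q" by auto
    obtain r where r: "r \<in> gap_polys m b"
      "\<And>x. poly r x = x ^ m + b * x ^ (m - 1) + (\<Sum>i\<le>m - 2. - q i * x ^ i)"
      using gap_polys_of_coeffs[OF assms, of b "\<lambda>i. - q i"] by auto
    have "((\<Sum>i\<le>m - 2. q i * x ^ i) - b * x ^ (m - 1) - x ^ m)\<^sup>2 = (poly r x)\<^sup>2" for x
      unfolding r(2) power2_eq_iff by (auto simp: sum_negf)
    then have "y = E \<xi> (\<lambda>x. (poly r x)\<^sup>2)" unfolding y by simp
    then show "y \<in> (\<lambda>r. E \<xi> (\<lambda>x. (poly r x)\<^sup>2)) ` gap_polys m b" using r(1) by blast
  next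
    fix y assume "y \<in> (\<lambda>r. E \<xi> (\<lambda>x. (poly r x)\<^sup>2)) ` gap_polys m b"
    then obtain r where r: "r \<in> gap_polys m b" "y = E \<xi> (\<lambda>x. (poly r x)\<^sup>2)" by auto
    have "(poly r x)\<^sup>2 = ((\<Sum>i\<le>m - 2. - coeff r i * x ^ i) - b * x ^ (m - 1) - x ^ m)\<^sup>2" for x
      unfolding poly_gap_polys[OF assms r(1)] power2_eq_iff by (auto simp: sum_negf)
    then have "y = ?F (\<lambda>i. - coeff r i)" unfolding r(2) by simp
    then show "y \<in> range ?F" by (rule range_eqI[where x = "\<lambda>i. - coeff r i"])
  qed
  then show ?thesis unfolding Tbar_def by simp
qed

lemma gap_polys_nonempty: "m \<ge> 2 \<Longrightarrow> gap_polys m b \<noteq> {}"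
  using gap_polys_of_coeffs[of m b "\<lambda>_. 0"] by blast

lemma bdd_below_mean_square:
  "bdd_below ((\<lambda>r. E \<xi> (\<lambda>x. (poly r x)\<^sup>2)) ` R)"
  by (rule bdd_belowI2[where m = 0]) simp

lemma Tbar_le:
  assumes "m \<ge> 2" "r \<in> gap_polys m b" shows "Tbar m \<xi> b \<le> E \<xi> (\<lambda>x. (poly r x)\<^sup>2)"
  unfolding Tbar_eq_INF[OF assms(1)] by (rule cINF_lower[OF bdd_below_mean_square assms(2)])

lemma Tbar_greatest:
  assumes "m \<ge> 2" "\<And>r. r \<in> gap_polys m b \<Longrightarrow> c \<le> E \<xi> (\<lambda>x. (poly r x)\<^sup>2)"
  shows "c \<le> Tbar m \<xi> b"
  unfolding Tbar_eq_INF[OF assms(1)] using assms by (intro cINF_greatest gap_polys_nonempty)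

lemma Tbar_nonneg: "m \<ge> 2 \<Longrightarrow> Tbar m \<xi> b \<ge> 0"
  by (rule Tbar_greatest) auto

text \<open>The normal equations of least squares: a residual that is orthogonal to all admissible changes is a
minimizer, by the theorem of Pythagoras.\<close>

lemma Tbar_eq_orthogonal:
  assumes m: "m \<ge> 2" and fin: "finite (set_pmf \<xi>)" and r: "r \<in> gap_polys m b"
    and orth: "\<And>q. degree q \<le> m - 2 \<Longrightarrow> E \<xi> (\<lambda>x. poly r x * poly q x) = 0"
  shows "Tbar m \<xi> b = E \<xi> (\<lambda>x. (poly r x)\<^sup>2)"
proof (rule antisym[OF Tbar_le[OF m r] Tbar_greatest[OF m]])
  fix r' assume "r' \<in> gap_polys m b"
  define d where "d = r' - r"
  have d: "degree d \<le> m - 2" unfolding d_def by (rule gap_polys_diff) fact+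
  have int: "integrable (measure_pmf \<xi>) f" for f :: "real \<Rightarrow> real"
    using fin by (rule integrable_measure_pmf_finite)
  have "E \<xi> (\<lambda>x. (poly r' x)\<^sup>2)
     = E \<xi> (\<lambda>x. (poly r x)\<^sup>2 + 2 * (poly r x * poly d x) + (poly d x)\<^sup>2)"
    by (simp add: d_def power2_eq_square algebra_simps)
  also have "\<dots> = E \<xi> (\<lambda>x. (poly r x)\<^sup>2) + E \<xi> (\<lambda>x. (poly d x)\<^sup>2)"
    using orth[OF d] by (simp add: int)
  finally show "E \<xi> (\<lambda>x. (poly r x)\<^sup>2) \<le> E \<xi> (\<lambda>x. (poly r' x)\<^sup>2)" by simp
qed

lemma pmf_of_finite_weights:
  fixes f :: "real \<Rightarrow> real"
  assumes S: "finite S" and f: "\<And>x. f x \<ge> 0" "\<And>x. x \<notin> S \<Longrightarrow> f x = 0" and one: "sum f S = 1"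
  obtains \<xi> where "pmf \<xi> = f" "set_pmf \<xi> \<subseteq> S" "\<And>g. E \<xi> g = (\<Sum>x\<in>S. f x * g x)"
proof -
  have "(\<integral>\<^sup>+x. ennreal (f x) \<partial>count_space UNIV) = (\<Sum>x\<in>S. ennreal (f x))"
    using S f(2) by (intro nn_integral_count_space') auto
  also have "\<dots> = 1" using f(1) one by (simp add: sum_ennreal)
  finally have p: "pmf (embed_pmf f) x = f x" for x using f(1) by (intro pmf_embed_pmf)
  have s: "set_pmf (embed_pmf f) \<subseteq> S" using f(2) p by (auto simp: set_pmf_eq)
  show thesis
  proof (rule that[OF _ s])
    show "pmf (embed_pmf f) = f" using p by auto
    show "E (embed_pmf f) g = (\<Sum>x\<in>S. f x * g x)" for g
      using s by (subst integral_measure_pmf_real[OF S]) (auto simp: p mult.commute)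
  qed
qed

section \<open>The value of the designs and upper bounds for all designs\<close>

text \<open>The square of the factor that makes \<open>cheb_J \<beta> (m - 1)\<close>, as a polynomial in \<open>x / a\<close>, monic.\<close>

definition gap_scale :: "nat \<Rightarrow> real \<Rightarrow> real" where
  "gap_scale m a = a ^ (2 * m) / 4 ^ (m - 1)"

text \<open>The scaling makes the polynomial a member of \<open>gap_polys m b\<close>.\<close>

definition cheb_gap :: "nat \<Rightarrow> real \<Rightarrow> real \<Rightarrow> real \<Rightarrow> real poly" where
  "cheb_gap m a \<beta> b = smult (a ^ m / 2 ^ (m - 1))
     (pcompose (cheb_J \<beta> (m - 1) + smult (2 * b / a) (cheb_T (m - 1))) [:0, 1 / a:])"

lemma cheb_gap_in:
  assumes m: "m \<ge> 2" and a: "a > 0" shows "cheb_gap m a \<beta> b \<in> gap_polys m b"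
proof -
  obtain n where n: "m = Suc n" "n \<ge> 1" using m by (cases m) auto
  have "degree (cheb_J \<beta> n + smult (2 * b / a) (cheb_T n)) \<le> Suc n"
    using coeff_cheb_J(3)[OF n(2), of \<beta>] coeff_cheb_T(2)[OF n(2)]
    by (intro degree_add_le) (auto intro: order.trans[OF degree_smult_le])
  then have "degree (cheb_gap m a \<beta> b) \<le> m"
    unfolding cheb_gap_def n using a
    by (intro order.trans[OF degree_smult_le] order.trans[OF degree_pcompose_le]) auto
  moreover have "coeff (cheb_gap m a \<beta> b) m = 1"
    using coeff_cheb_J(1)[OF n(2), of \<beta>] cheb_coeff_eq_0(1)[of n "Suc n"] a
    by (simp add: cheb_gap_def n coeff_pcompose_linear power_divide del: cheb_T.simps power_Suc)
  moreover have "coeff (cheb_gap m a \<beta> b) (m - 1) = b"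
  proof -
    have "(2::real) ^ n = 2 * 2 ^ (n - 1)" using n by (cases n) auto
    then show ?thesis
      using coeff_cheb_J(2)[OF n(2), of \<beta>] coeff_cheb_T(1)[OF n(2)] a
      by (simp add: cheb_gap_def n coeff_pcompose_linear power_divide)
  qed
  ultimately show ?thesis by (simp add: gap_polys_def)
qed

lemma poly_cheb_gap_sq:
  assumes "m \<ge> 1"
  shows "(poly (cheb_gap m a \<beta> b) x)\<^sup>2 = gap_scale m a *
    (poly (cheb_J \<beta> (m - 1)) (x / a) + 2 * b / a * poly (cheb_T (m - 1)) (x / a))\<^sup>2"
proof -
  have "((2::real) ^ (m - 1))\<^sup>2 = 4 ^ (m - 1)"
    by (simp flip: power_mult_distrib add: power2_eq_square)
  moreover have "(a ^ m)\<^sup>2 = a ^ (2 * m)"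
    by (simp add: power_mult[symmetric] mult.commute)
  ultimately show ?thesis
    by (simp add: cheb_gap_def poly_pcompose gap_scale_def power_mult_distrib power_divide)
qed

lemma xi_design:
  assumes m: "m \<ge> 2" and \<beta>: "0 \<le> \<beta>" "\<beta> \<le> 1" and a: "a > 0"
  shows "\<exists>\<xi>. pmf \<xi> = xi_mass m a \<beta> \<and> approximate_design a \<xi> \<and>
    (\<forall>b. Tbar m \<xi> b = gap_scale m a * ((1 + \<beta>) * (2 * (b / a)\<^sup>2 + (1 - \<beta>))))"
proof -
  obtain n where n: "m = Suc n" "n \<ge> 1" using m by (cases m) auto
  define w where "w y = xi_mass (Suc n) a \<beta> (a * y)" for y
  obtain X :: "real set" where X: "finite X" "X \<subseteq> {-1..1}"
    "\<And>y. y \<notin> X \<Longrightarrow> w y = 0" "\<And>y. w y \<ge> 0" "(\<Sum>y\<in>X. w y) = 1"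
    and orthT: "\<And>q. degree q < n \<Longrightarrow> (\<Sum>y\<in>X. w y * (poly (cheb_T n) y * poly q y)) = 0"
    and orthJ: "\<And>q. degree q < n \<Longrightarrow> (\<Sum>y\<in>X. w y * (poly (cheb_J \<beta> n) y * poly q y)) = 0"
    and TT: "(\<Sum>y\<in>X. w y * (poly (cheb_T n) y)\<^sup>2) = (1 + \<beta>) / 2"
    and JT: "(\<Sum>y\<in>X. w y * (poly (cheb_J \<beta> n) y * poly (cheb_T n) y)) = 0"
    and JJ: "(\<Sum>y\<in>X. w y * (poly (cheb_J \<beta> n) y)\<^sup>2) = 1 - \<beta>\<^sup>2"
    by (rule optimal_moments[OF n(2) \<beta> a, folded w_def]) (rule that; assumption)
  define S where "S = (*) a ` X"
  have inj: "inj_on ((*) a) X" using a by (auto simp: inj_on_def)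
  have fa: "xi_mass m a \<beta> x = w (x / a)" for x using a by (simp add: w_def n)
  have S: "finite S" using X by (simp add: S_def)
  have nonneg: "xi_mass m a \<beta> x \<ge> 0" for x unfolding fa by (rule X)
  have zero: "xi_mass m a \<beta> x = 0" if "x \<notin> S" for x
  proof -
    have "x / a \<notin> X"
    proof
      assume "x / a \<in> X"
      then have "a * (x / a) \<in> S" unfolding S_def by blast
      then show False using that a by simp
    qed
    then show ?thesis unfolding fa by (rule X)
  qed
  have one: "sum (xi_mass m a \<beta>) S = 1"
    unfolding S_def using X(5) inj a by (simp add: sum.reindex fa)
  obtain \<xi> where \<xi>: "pmf \<xi> = xi_mass m a \<beta>" "set_pmf \<xi> \<subseteq> S"
    "\<And>g. E \<xi> g = (\<Sum>x\<in>S. xi_mass m a \<beta> x * g x)"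
    by (rule pmf_of_finite_weights[OF S nonneg zero one]; (assumption | rule that; assumption))
  have EX: "E \<xi> (\<lambda>x. g (x / a)) = (\<Sum>y\<in>X. w y * g y)" for g
    unfolding \<xi>(3) S_def using inj a by (simp add: sum.reindex fa)
  have des: "approximate_design a \<xi>"
  proof -
    have "S \<subseteq> {-a..a}"
    proof
      fix x assume "x \<in> S"
      then obtain y where "x = a * y" "\<bar>y\<bar> \<le> 1" using X(2) by (force simp: S_def)
      then have "\<bar>x\<bar> \<le> a" using a mult_left_mono[of "\<bar>y\<bar>" 1 a] by (simp add: abs_mult)
      then show "x \<in> {-a..a}" by auto
    qed
    then show ?thesis
      unfolding approximate_design_def using \<xi>(2) S finite_subset by blast
  qed
  have "Tbar m \<xi> b = gap_scale m a * ((1 + \<beta>) * (2 * (b / a)\<^sup>2 + (1 - \<beta>)))" for b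
  proof -
    let ?r = "cheb_gap m a \<beta> b"
    define f where "f y = poly (cheb_J \<beta> n) y + 2 * b / a * poly (cheb_T n) y" for y
    have "Tbar m \<xi> b = E \<xi> (\<lambda>x. (poly ?r x)\<^sup>2)"
    proof (rule Tbar_eq_orthogonal[OF m _ cheb_gap_in[OF m a]])
      show "finite (set_pmf \<xi>)" using des by (simp add: approximate_design_def)
      fix q :: "real poly" assume q: "degree q \<le> m - 2"
      define q' where "q' = pcompose q [:0, a:]"
      have "degree q' < n" using q n a by (simp add: q'_def degree_pcompose)
      have "poly ?r x * poly q x = a ^ m / 2 ^ (m - 1) * (f (x / a) * poly q' (x / a))" for x
        using a by (simp add: cheb_gap_def poly_pcompose f_def q'_def n)
      then have "E \<xi> (\<lambda>x. poly ?r x * poly q x)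
          = a ^ m / 2 ^ (m - 1) * E \<xi> (\<lambda>x. f (x / a) * poly q' (x / a))" by simp
      also have "E \<xi> (\<lambda>x. f (x / a) * poly q' (x / a)) = (\<Sum>y\<in>X. w y * (f y * poly q' y))"
        by (rule EX)
      also have "\<dots> = (\<Sum>y\<in>X. w y * (poly (cheb_J \<beta> n) y * poly q' y))
          + 2 * b / a * (\<Sum>y\<in>X. w y * (poly (cheb_T n) y * poly q' y))"
        unfolding sum_distrib_left sum.distrib[symmetric]
        by (intro sum.cong) (simp_all add: f_def algebra_simps)
      also have "\<dots> = 0" using orthT orthJ \<open>degree q' < n\<close> by simp
      finally show "E \<xi> (\<lambda>x. poly ?r x * poly q x) = 0" by simp
    qed
    also have "\<dots> = gap_scale m a * E \<xi> (\<lambda>x. (f (x / a))\<^sup>2)"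
      using m by (simp add: poly_cheb_gap_sq f_def n)
    also have "E \<xi> (\<lambda>x. (f (x / a))\<^sup>2) = (\<Sum>y\<in>X. w y * (f y)\<^sup>2)"
      by (rule EX)
    also have "\<dots> = (\<Sum>y\<in>X. w y * (poly (cheb_J \<beta> n) y)\<^sup>2)
        + 4 * b / a * (\<Sum>y\<in>X. w y * (poly (cheb_J \<beta> n) y * poly (cheb_T n) y))
        + 4 * (b / a)\<^sup>2 * (\<Sum>y\<in>X. w y * (poly (cheb_T n) y)\<^sup>2)"
      unfolding sum_distrib_left sum.distrib[symmetric]
      by (intro sum.cong) (simp_all add: f_def algebra_simps power2_eq_square)
    also have "\<dots> = (1 + \<beta>) * (2 * (b / a)\<^sup>2 + (1 - \<beta>))"
    proof -
      have "1 - \<beta>\<^sup>2 + 4 * b / a * 0 + 4 * s * ((1 + \<beta>) / 2) = (1 + \<beta>) * (2 * s + (1 - \<beta>))" for s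
        by (simp add: algebra_simps power2_eq_square)
      then show ?thesis unfolding JJ JT TT .
    qed
    finally show ?thesis .
  qed
  with \<xi>(1) des show ?thesis by blast
qed

lemma design_integrable:
  "approximate_design a \<xi> \<Longrightarrow> integrable (measure_pmf \<xi>) (f :: real \<Rightarrow> real)"
  unfolding approximate_design_def by (blast intro: integrable_measure_pmf_finite)

lemma design_mono:
  assumes "approximate_design a \<xi>" "\<And>x. \<bar>x\<bar> \<le> a \<Longrightarrow> f x \<le> g x"
  shows "E \<xi> f \<le> E \<xi> g"
proof (rule integral_mono_AE[OF design_integrable design_integrable])
  show "AE x in measure_pmf \<xi>. f x \<le> g x"
    unfolding AE_measure_pmf_iff using assms by (force simp: approximate_design_def)
qed (fact assms(1))+

lemma design_le_const:
  assumes "approximate_design a \<xi>" "\<And>x. \<bar>x\<bar> \<le> a \<Longrightarrow> f x \<le> c" shows "E \<xi> f \<le> c"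
  using design_mono[OF assms(1), of f "\<lambda>_. c"] assms(2) by simp

text \<open>The test polynomial \<open>cheb_gap m a \<beta> b\<close> depends on \<open>b\<close> in an affine way, so that the bound is
quadratic in \<open>b\<close> with coefficients that do not depend on \<open>b\<close>.\<close>

lemma Tbar_le_moments:
  assumes m: "m \<ge> 2" and a: "a > 0" and \<xi>: "approximate_design a \<xi>"
  shows "Tbar m \<xi> b \<le> gap_scale m a *
    (E \<xi> (\<lambda>x. (poly (cheb_J \<beta> (m - 1)) (x / a))\<^sup>2)
     + 4 * b / a * E \<xi> (\<lambda>x. poly (cheb_J \<beta> (m - 1)) (x / a) * poly (cheb_T (m - 1)) (x / a))
     + 4 * (b / a)\<^sup>2 * E \<xi> (\<lambda>x. (poly (cheb_T (m - 1)) (x / a))\<^sup>2))"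
proof -
  let ?J = "\<lambda>x. poly (cheb_J \<beta> (m - 1)) (x / a)" and ?T = "\<lambda>x. poly (cheb_T (m - 1)) (x / a)"
  have "Tbar m \<xi> b \<le> E \<xi> (\<lambda>x. (poly (cheb_gap m a \<beta> b) x)\<^sup>2)"
    by (intro Tbar_le cheb_gap_in m a)
  also have "\<dots> = gap_scale m a * E \<xi> (\<lambda>x. (?J x + 2 * b / a * ?T x)\<^sup>2)"
    using m by (simp add: poly_cheb_gap_sq)
  also have "(\<lambda>x. (?J x + 2 * b / a * ?T x)\<^sup>2)
      = (\<lambda>x. (?J x)\<^sup>2 + 4 * b / a * (?J x * ?T x) + 4 * (b / a)\<^sup>2 * (?T x)\<^sup>2)"
    by (intro ext) (simp add: algebra_simps power2_eq_square)
  also have "E \<xi> \<dots> = E \<xi> (\<lambda>x. (?J x)\<^sup>2) + 4 * b / a * E \<xi> (\<lambda>x. ?J x * ?T x)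
      + 4 * (b / a)\<^sup>2 * E \<xi> (\<lambda>x. (?T x)\<^sup>2)"
    by (simp add: design_integrable[OF \<xi>])
  finally show ?thesis .
qed

lemma moment_bounds:
  assumes a: "a > 0" and \<xi>: "approximate_design a \<xi>"
  shows "E \<xi> (\<lambda>x. (poly (cheb_J \<beta> n) (x / a))\<^sup>2)
      + 4 * \<beta> * E \<xi> (\<lambda>x. (poly (cheb_T n) (x / a))\<^sup>2) \<le> (1 + \<beta>)\<^sup>2"
    and "E \<xi> (\<lambda>x. (poly (cheb_T n) (x / a))\<^sup>2) \<le> 1"
proof -
  have "E \<xi> (\<lambda>x. (poly (cheb_J \<beta> n) (x / a))\<^sup>2 + 4 * \<beta> * (poly (cheb_T n) (x / a))\<^sup>2) \<le> (1 + \<beta>)\<^sup>2"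
    using a by (intro design_le_const[OF \<xi>] equioscillation_bound) (auto simp: divide_simps)
  then show "E \<xi> (\<lambda>x. (poly (cheb_J \<beta> n) (x / a))\<^sup>2)
      + 4 * \<beta> * E \<xi> (\<lambda>x. (poly (cheb_T n) (x / a))\<^sup>2) \<le> (1 + \<beta>)\<^sup>2"
    by (simp add: design_integrable[OF \<xi>])
  show "E \<xi> (\<lambda>x. (poly (cheb_T n) (x / a))\<^sup>2) \<le> 1"
    using a by (intro design_le_const[OF \<xi>] cheb_T_sq_le) (auto simp: divide_simps)
qed

text \<open>Let \<open>y\<close> be the mean square of \<open>T\<^sub>n\<close>. The parameter \<open>\<beta>\<close> is chosen such that the design
\<open>\<xi>\<^bsub>m,\<beta>\<^esub>\<close> has the same \<open>y = (1 + \<beta>) / 2\<close>, or \<open>\<beta> = 0\<close> if \<open>y\<close> is too small for that. For this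
\<open>\<beta>\<close> the bound \<open>equioscillation_bound\<close> shows that the mean square of \<open>J\<close> is at most its value
\<open>1 - \<beta>\<^sup>2\<close> at \<open>\<xi>\<^bsub>m,\<beta>\<^esub>\<close>. Adding the estimates for \<open>b\<close> and \<open>-b\<close> cancels the mixed term.\<close>

lemma design_dominated:
  assumes m: "m \<ge> 2" and a: "a > 0" and \<xi>: "approximate_design a \<xi>"
  shows "\<exists>\<beta>. 0 \<le> \<beta> \<and> \<beta> \<le> 1 \<and> (\<forall>b. Tbar m \<xi> b + Tbar m \<xi> (-b)
      \<le> 2 * (gap_scale m a * ((1 + \<beta>) * (2 * (b / a)\<^sup>2 + (1 - \<beta>)))))"
proof -
  define y where "y = E \<xi> (\<lambda>x. (poly (cheb_T (m - 1)) (x / a))\<^sup>2)"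
  define \<beta> where "\<beta> = max 0 (2 * y - 1)"
  define A where "A = E \<xi> (\<lambda>x. (poly (cheb_J \<beta> (m - 1)) (x / a))\<^sup>2)"
  define C where "C = E \<xi> (\<lambda>x. poly (cheb_J \<beta> (m - 1)) (x / a) * poly (cheb_T (m - 1)) (x / a))"
  have y1: "y \<le> 1" unfolding y_def by (rule moment_bounds(2)[OF a \<xi>])
  have A: "A + 4 * \<beta> * y \<le> (1 + \<beta>)\<^sup>2" unfolding A_def y_def by (rule moment_bounds(1)[OF a \<xi>])
  have \<beta>: "0 \<le> \<beta>" "\<beta> \<le> 1" using y1 by (auto simp: \<beta>_def)
  have y\<beta>: "y \<le> (1 + \<beta>) / 2" by (simp add: \<beta>_def)
  have A\<beta>: "A \<le> (1 + \<beta>) * (1 - \<beta>)"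
  proof (cases "y \<ge> 1 / 2")
    case True
    then have y2: "2 * y = 1 + \<beta>" by (simp add: \<beta>_def)
    have "A + 2 * \<beta> * (2 * y) \<le> (1 + \<beta>)\<^sup>2" using A by simp
    then show ?thesis unfolding y2 by (simp add: algebra_simps power2_eq_square)
  next
    case False
    then have "\<beta> = 0" by (simp add: \<beta>_def)
    then show ?thesis using A by simp
  qed
  have s0: "gap_scale m a \<ge> 0" using a by (simp add: gap_scale_def)
  show ?thesis
  proof (intro exI[of _ \<beta>] conjI \<beta> allI)
    fix b
    have "Tbar m \<xi> b + Tbar m \<xi> (-b) \<le> gap_scale m a * (A + 4 * b / a * C + 4 * (b / a)\<^sup>2 * y)
        + gap_scale m a * (A + 4 * (-b) / a * C + 4 * ((-b) / a)\<^sup>2 * y)"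
      unfolding A_def C_def y_def by (intro add_mono Tbar_le_moments[OF m a \<xi>])
    also have "\<dots> = 2 * (gap_scale m a * (A + 4 * (b / a)\<^sup>2 * y))"
      by (simp add: algebra_simps)
    also have "\<dots> \<le> 2 * (gap_scale m a * ((1 + \<beta>) * (1 - \<beta>) + 4 * (b / a)\<^sup>2 * ((1 + \<beta>) / 2)))"
      using s0 A\<beta> y\<beta> by (intro mult_left_mono add_mono) auto
    also have "(1 + \<beta>) * (1 - \<beta>) + 4 * (b / a)\<^sup>2 * ((1 + \<beta>) / 2)
        = (1 + \<beta>) * (2 * (b / a)\<^sup>2 + (1 - \<beta>))"
      by (simp add: algebra_simps)
    finally show "Tbar m \<xi> b + Tbar m \<xi> (-b)
      \<le> 2 * (gap_scale m a * ((1 + \<beta>) * (2 * (b / a)\<^sup>2 + (1 - \<beta>))))" .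
  qed
qed

section \<open>Duality between designs and uniform approximation\<close>

definition mix_pmf :: "real \<Rightarrow> real pmf \<Rightarrow> real pmf \<Rightarrow> real pmf" where
  "mix_pmf \<alpha> \<nu> \<xi> = bernoulli_pmf \<alpha> \<bind> (\<lambda>c. if c then \<nu> else \<xi>)"

lemma mix_pmf:
  assumes "0 \<le> \<alpha>" "\<alpha> \<le> 1" "approximate_design a \<nu>" "approximate_design a \<xi>"
  shows "approximate_design a (mix_pmf \<alpha> \<nu> \<xi>)"
    and "E (mix_pmf \<alpha> \<nu> \<xi>) f = \<alpha> * E \<nu> f + (1 - \<alpha>) * E \<xi> f"
proof -
  show "approximate_design a (mix_pmf \<alpha> \<nu> \<xi>)"
    using assms(3,4) unfolding approximate_design_def mix_pmf_def
    by (auto simp: subset_iff split: if_splits)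
  show "E (mix_pmf \<alpha> \<nu> \<xi>) f = \<alpha> * E \<nu> f + (1 - \<alpha>) * E \<xi> f"
    unfolding mix_pmf_def using assms
    by (subst pmf_expectation_bind[where A = UNIV]) (auto simp: approximate_design_def UNIV_bool)
qed

lemma poly_sq_bounded:
  fixes r :: "real poly"
  shows "\<exists>C. \<forall>x. \<bar>x\<bar> \<le> a \<longrightarrow> (poly r x)\<^sup>2 \<le> C"
proof -
  have "compact ((\<lambda>x. (poly r x)\<^sup>2) ` {-a..a})"
    by (intro compact_continuous_image continuous_intros) simp
  then have "bdd_above ((\<lambda>x. (poly r x)\<^sup>2) ` {-a..a})"
    by (intro bounded_imp_bdd_above compact_imp_bounded)
  then obtain C where "\<forall>y\<in>(\<lambda>x. (poly r x)\<^sup>2) ` {-a..a}. y \<le> C"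
    unfolding bdd_above_def by blast
  then have "\<forall>x. \<bar>x\<bar> \<le> a \<longrightarrow> (poly r x)\<^sup>2 \<le> C" by (auto simp: abs_le_iff)
  then show ?thesis by blast
qed

text \<open>Equivalence of norms on polynomials of bounded degree, for the uniform distribution on sufficiently many
points.\<close>

lemma sup_norm_le_design_norm:
  assumes a: "a > 0"
  obtains \<mu> K where "approximate_design a \<mu>" "K > 0"
    "\<And>d x. degree d \<le> k \<Longrightarrow> \<bar>x\<bar> \<le> a \<Longrightarrow> (poly d x)\<^sup>2 \<le> K * E \<mu> (\<lambda>x. (poly d x)\<^sup>2)"
proof -
  have "infinite {0..a}" using a by (simp add: infinite_Icc)
  then obtain X where X: "finite X" "card X = Suc k" "X \<subseteq> {0..a}"
    using infinite_arbitrarily_large by metis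
  have X0: "X \<noteq> {}" using X(2) by auto
  define l where "l y = smult (1 / poly (other_nodes X y) y) (other_nodes X y)" for y
  obtain C where C: "\<And>x y. \<bar>x\<bar> \<le> a \<Longrightarrow> (poly (l y) x)\<^sup>2 \<le> C y"
    using poly_sq_bounded[of a "l _"] by metis
  have C0: "C y \<ge> 0" for y using order.trans[OF zero_le_power2 C[of 0 y]] a by simp
  define K where "K = ((\<Sum>y\<in>X. C y) + 1) * real (Suc k)"
  show thesis
  proof (rule that[of "pmf_of_set X" K])
    show "approximate_design a (pmf_of_set X)"
      using X X0 a by (force simp: approximate_design_def)
    show "K > 0" unfolding K_def using C0 by (intro mult_pos_pos add_nonneg_pos sum_nonneg) auto
    fix d :: "real poly" and x :: real assume d: "degree d \<le> k" and x: "\<bar>x\<bar> \<le> a"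
    have "d = (\<Sum>y\<in>X. smult (poly d y) (l y))"
      using lagrange_interpolation[OF X(1), of d] d X(2) by (simp add: l_def)
    then have "poly d x = (\<Sum>y\<in>X. poly d y * poly (l y) x)"
      by (metis (no_types, lifting) poly_smult poly_sum sum.cong)
    then have "(poly d x)\<^sup>2 \<le> (\<Sum>y\<in>X. (poly d y)\<^sup>2) * (\<Sum>y\<in>X. (poly (l y) x)\<^sup>2)"
      by (simp add: Cauchy_Schwarz_ineq_sum)
    also have "\<dots> \<le> (\<Sum>y\<in>X. (poly d y)\<^sup>2) * ((\<Sum>y\<in>X. C y) + 1)"
      using sum_mono[of X "\<lambda>y. (poly (l y) x)\<^sup>2" C] C[OF x]
      by (intro mult_left_mono sum_nonneg) (auto intro: order.trans)
    also have "\<dots> = K * E (pmf_of_set X) (\<lambda>x. (poly d x)\<^sup>2)"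
      using X X0 by (simp add: integral_pmf_of_set K_def)
    finally show "(poly d x)\<^sup>2 \<le> K * E (pmf_of_set X) (\<lambda>x. (poly d x)\<^sup>2)" .
  qed
qed

lemma Tbar_bounded:
  assumes "m \<ge> 2"
  obtains C where "\<And>\<xi>. approximate_design a \<xi> \<Longrightarrow> Tbar m \<xi> b \<le> C"
proof -
  obtain r where r: "r \<in> gap_polys m b" using gap_polys_nonempty[OF assms] by blast
  obtain C where C: "\<And>x. \<bar>x\<bar> \<le> a \<Longrightarrow> (poly r x)\<^sup>2 \<le> C"
    using poly_sq_bounded by blast
  show thesis
    by (rule that[of C], rule order.trans[OF Tbar_le[OF assms r]], rule design_le_const)
       (use C in auto)
qed

lemma Tbar_le_Rbar:
  assumes "m \<ge> 2" "approximate_design a \<xi>" shows "Tbar m \<xi> b \<le> Rbar m a b"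
proof -
  obtain C where "\<And>\<xi>. approximate_design a \<xi> \<Longrightarrow> Tbar m \<xi> b \<le> C"
    using Tbar_bounded[OF assms(1)] by blast
  then have "bdd_above ((\<lambda>\<xi>. Tbar m \<xi> b) ` Collect (approximate_design a))"
    by (intro bdd_aboveI2[where M = C]) auto
  then show ?thesis unfolding Rbar_def using assms(2) by (intro cSUP_upper) auto
qed

lemma Rbar_least:
  assumes "a > 0" "\<And>\<xi>. approximate_design a \<xi> \<Longrightarrow> Tbar m \<xi> b \<le> c"
  shows "Rbar m a b \<le> c"
proof -
  have "approximate_design a (return_pmf 0)" using assms(1) by (simp add: approximate_design_def)
  then show ?thesis unfolding Rbar_def using assms(2) by (intro cSUP_least) auto
qed

text \<open>The left-hand side is the minimum over \<open>t\<close> of the right-hand side.\<close>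

lemma weighted_square_bound:
  fixes p c :: real
  assumes "p > 0" "c > 0"
  shows "p * c / (p + c) * r\<^sup>2 \<le> p * (r - t)\<^sup>2 + c * t\<^sup>2"
proof -
  have "(p + c) * (p * (r - t)\<^sup>2 + c * t\<^sup>2) - p * c * r\<^sup>2 = (p * (r - t) - c * t)\<^sup>2"
    by (simp add: algebra_simps power2_eq_square)
  then have "p * c * r\<^sup>2 \<le> (p + c) * (p * (r - t)\<^sup>2 + c * t\<^sup>2)" by (metis diff_ge_0_iff_ge zero_le_power2)
  then show ?thesis using assms by (simp add: divide_le_eq mult.commute)
qed

text \<open>The idea is that of the equivalence theorem of optimal design: at an optimal design \<open>\<xi>'\<close> with
residual \<open>r\<close>, moving a small mass \<open>\<alpha>\<close> to a point \<open>x\<close> would improve the criterion if \<open>(r x)\<^sup>2\<close>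
exceeded the mean square of \<open>r\<close>. Two difficulties are removed by perturbation. An optimal design is
replaced by one that is optimal up to \<open>\<epsilon>\<close>, and its residual by a nearly minimal one. And after the
move the least squares fit changes by some \<open>d\<close>, which could be large at \<open>x\<close> without costing much in the
mean; to exclude this, all designs are required to contain the fixed part \<open>\<gamma> \<mu>\<close>, whose norm controls
the value of \<open>d\<close> at \<open>x\<close>. The sizes \<open>\<alpha> = \<gamma>\<^sup>2\<close> and \<open>\<epsilon> = \<alpha>\<^sup>2\<close> are such that all errors vanish
as \<open>\<gamma>\<close> tends to zero.\<close>

lemma near_minimax_step:
  assumes m: "m \<ge> 2" and a: "a > 0" and \<gamma>: "0 < \<gamma>" "\<gamma> < 1"
    and \<mu>: "approximate_design a \<mu>" and K: "K > 0"
    and norm: "\<And>d x. degree d \<le> m - 2 \<Longrightarrow> \<bar>x\<bar> \<le> a \<Longrightarrow> (poly d x)\<^sup>2 \<le> K * E \<mu> (\<lambda>x. (poly d x)\<^sup>2)"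
  shows "\<exists>r\<in>gap_polys m b. \<forall>x. \<bar>x\<bar> \<le> a \<longrightarrow> (poly r x)\<^sup>2 \<le>
    (Rbar m a b + 3 * \<gamma>\<^sup>2) * (1 / (1 - \<gamma>) + 2 * K * \<gamma> / (1 - \<gamma>\<^sup>2))"
proof -
  define D where "D = mix_pmf \<gamma> \<mu> ` Collect (approximate_design a)"
  have Ddes: "approximate_design a \<xi>" if "\<xi> \<in> D" for \<xi>
    using that \<gamma> \<mu> by (auto simp: D_def intro: mix_pmf(1))
  have D0: "D \<noteq> {}" using \<mu> by (auto simp: D_def)
  define S where "S = (SUP \<xi>\<in>D. Tbar m \<xi> b)"
  obtain C where "\<And>\<xi>. approximate_design a \<xi> \<Longrightarrow> Tbar m \<xi> b \<le> C"
    using Tbar_bounded[OF m] by blast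
  then have bdd: "bdd_above ((\<lambda>\<xi>. Tbar m \<xi> b) ` D)"
    using Ddes by (intro bdd_aboveI2[where M = C]) auto
  have TS: "Tbar m \<xi> b \<le> S" if "\<xi> \<in> D" for \<xi>
    unfolding S_def by (rule cSUP_upper[OF that bdd])
  have SR: "S \<le> Rbar m a b"
    unfolding S_def using D0 Tbar_le_Rbar[OF m] Ddes by (intro cSUP_least) auto
  define \<alpha> \<epsilon> where "\<alpha> = \<gamma>\<^sup>2" and "\<epsilon> = \<alpha>\<^sup>2"
  have \<alpha>: "0 < \<alpha>" "\<alpha> < 1" using \<gamma> by (auto simp: \<alpha>_def power_less_one_iff)
  have \<epsilon>: "\<epsilon> > 0" using \<alpha> by (simp add: \<epsilon>_def)
  have "S - \<epsilon> < S" using \<epsilon> by simp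
  then obtain \<xi>' where \<xi>': "\<xi>' \<in> D" "S - \<epsilon> < Tbar m \<xi>' b"
    using less_cSUP_iff[OF D0 bdd] unfolding S_def by blast
  then obtain \<xi> where \<xi>: "approximate_design a \<xi>" "\<xi>' = mix_pmf \<gamma> \<mu> \<xi>" by (auto simp: D_def)
  have E': "E \<xi>' f = \<gamma> * E \<mu> f + (1 - \<gamma>) * E \<xi> f" for f
    unfolding \<xi>(2) using \<gamma> \<mu> \<xi>(1) by (intro mix_pmf(2)) auto
  have "\<exists>r\<in>gap_polys m b. E \<xi>' (\<lambda>x. (poly r x)\<^sup>2) < Tbar m \<xi>' b + \<epsilon>"
  proof (rule ccontr)
    assume "\<not> ?thesis"
    then have "Tbar m \<xi>' b + \<epsilon> \<le> Tbar m \<xi>' b"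
      by (intro Tbar_greatest[OF m]) (auto simp: not_less)
    then show False using \<epsilon> by simp
  qed
  then obtain r where r: "r \<in> gap_polys m b" "E \<xi>' (\<lambda>x. (poly r x)\<^sup>2) < Tbar m \<xi>' b + \<epsilon>" by blast
  note int = design_integrable[OF Ddes[OF \<xi>'(1)]]
  have near_orth: "Tbar m \<xi>' b - 2 * \<epsilon> + E \<xi>' (\<lambda>x. (poly d x)\<^sup>2) / 2 \<le> E \<xi>' (\<lambda>x. (poly (r + d) x)\<^sup>2)"
    if d: "degree d \<le> m - 2" for d
  proof -
    have exp: "E \<xi>' (\<lambda>x. (poly (r + smult s d) x)\<^sup>2) = E \<xi>' (\<lambda>x. (poly r x)\<^sup>2)
        + 2 * s * E \<xi>' (\<lambda>x. poly r x * poly d x) + s\<^sup>2 * E \<xi>' (\<lambda>x. (poly d x)\<^sup>2)" for s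
    proof -
      have "(\<lambda>x. (poly (r + smult s d) x)\<^sup>2)
          = (\<lambda>x. (poly r x)\<^sup>2 + 2 * s * (poly r x * poly d x) + s\<^sup>2 * (poly d x)\<^sup>2)"
        by (intro ext) (simp add: algebra_simps power2_eq_square)
      then show ?thesis by (simp add: int)
    qed
    \<comment> \<open>Minimality up to \<open>\<epsilon>\<close> against half of the change bounds the mixed term by a quarter of the mean square of
\<open>d\<close>; so at least half of that mean square survives in the full change.\<close>
    have "r + smult (1 / 2) d \<in> gap_polys m b"
      using d by (intro gap_polys_add[OF m r(1)]) simp
    from Tbar_le[OF m this, of \<xi>'] have "Tbar m \<xi>' b \<le> E \<xi>' (\<lambda>x. (poly r x)\<^sup>2)
        + E \<xi>' (\<lambda>x. poly r x * poly d x) + E \<xi>' (\<lambda>x. (poly d x)\<^sup>2) / 4"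
      unfolding exp by (simp add: power2_eq_square)
    moreover have "Tbar m \<xi>' b \<le> E \<xi>' (\<lambda>x. (poly r x)\<^sup>2)" by (rule Tbar_le[OF m r(1)])
    ultimately show ?thesis using r(2) exp[of 1] by simp
  qed
  show ?thesis
  proof (intro bexI[OF _ r(1)] allI impI)
    fix x assume x: "\<bar>x\<bar> \<le> a"
    \<comment> \<open>In the criterion of the moved design, \<open>p\<close> is the mass added at \<open>x\<close>, and \<open>c (d x)\<^sup>2\<close> is the guaranteed
cost of changing the fit by \<open>d\<close>.\<close>
    define p c where "p = \<alpha> * (1 - \<gamma>)" and "c = (1 - \<alpha>) * \<gamma> / (2 * K)"
    have pc: "p > 0" "c > 0" using \<alpha> \<gamma> K by (auto simp: p_def c_def)
    define \<delta> where "\<delta> = return_pmf x"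
    have \<delta>: "approximate_design a \<delta>" using x by (auto simp: \<delta>_def approximate_design_def)
    have mix: "approximate_design a (mix_pmf \<alpha> \<delta> \<xi>)" using \<alpha> \<delta> \<xi>(1) by (intro mix_pmf(1)) auto
    define \<zeta> where "\<zeta> = mix_pmf \<gamma> \<mu> (mix_pmf \<alpha> \<delta> \<xi>)"
    have "\<zeta> \<in> D" using mix by (auto simp: D_def \<zeta>_def)
    have E\<zeta>: "E \<zeta> f = \<alpha> * (\<gamma> * E \<mu> f) + p * f x + (1 - \<alpha>) * E \<xi>' f" for f
    proof -
      have "E \<zeta> f = \<gamma> * E \<mu> f + (1 - \<gamma>) * E (mix_pmf \<alpha> \<delta> \<xi>) f"
        unfolding \<zeta>_def using \<gamma> \<mu> mix by (intro mix_pmf(2)) auto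
      also have "E (mix_pmf \<alpha> \<delta> \<xi>) f = \<alpha> * f x + (1 - \<alpha>) * E \<xi> f"
        using \<alpha> \<delta> \<xi>(1) by (subst mix_pmf(2)) (auto simp: \<delta>_def)
      finally show ?thesis unfolding E' p_def by (simp add: algebra_simps)
    qed
    have "p * c / (p + c) * (poly r x)\<^sup>2 + (1 - \<alpha>) * (S - 3 * \<epsilon>) \<le> Tbar m \<zeta> b"
    proof (rule Tbar_greatest[OF m])
      fix r' assume r': "r' \<in> gap_polys m b"
      define d where "d = r' - r"
      have d: "degree d \<le> m - 2" unfolding d_def by (rule gap_polys_diff[OF m r' r(1)])
      have r'eq: "r' = r + d" by (simp add: d_def)
      have dx: "\<gamma> / K * (poly d x)\<^sup>2 \<le> E \<xi>' (\<lambda>x. (poly d x)\<^sup>2)"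
      proof -
        have "\<gamma> / K * (poly d x)\<^sup>2 \<le> \<gamma> / K * (K * E \<mu> (\<lambda>x. (poly d x)\<^sup>2))"
          using \<gamma> K by (intro mult_left_mono norm[OF d x]) auto
        also have "\<dots> = \<gamma> * E \<mu> (\<lambda>x. (poly d x)\<^sup>2)" using K by simp
        also have "\<dots> \<le> E \<xi>' (\<lambda>x. (poly d x)\<^sup>2)" unfolding E' using \<gamma> by simp
        finally show ?thesis .
      qed
      have "p * c / (p + c) * (poly r x)\<^sup>2 + (1 - \<alpha>) * (S - 3 * \<epsilon>)
          \<le> p * (poly r' x)\<^sup>2 + c * (poly d x)\<^sup>2 + (1 - \<alpha>) * (S - 3 * \<epsilon>)"
        using weighted_square_bound[OF pc, of "poly r x" "- poly d x"] by (simp add: r'eq)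
      also have "c * (poly d x)\<^sup>2 = (1 - \<alpha>) * (\<gamma> / K * (poly d x)\<^sup>2 / 2)" by (simp add: c_def)
      also have "\<dots> \<le> (1 - \<alpha>) * (E \<xi>' (\<lambda>x. (poly d x)\<^sup>2) / 2)"
        using \<alpha> dx by (intro mult_left_mono divide_right_mono) auto
      also have "p * (poly r' x)\<^sup>2 + \<dots> + (1 - \<alpha>) * (S - 3 * \<epsilon>)
          = p * (poly r' x)\<^sup>2 + (1 - \<alpha>) * (S - 3 * \<epsilon> + E \<xi>' (\<lambda>x. (poly d x)\<^sup>2) / 2)"
        by (simp add: algebra_simps)
      also have "\<dots> \<le> p * (poly r' x)\<^sup>2 + (1 - \<alpha>) * E \<xi>' (\<lambda>x. (poly r' x)\<^sup>2)"
        using \<alpha> near_orth[OF d] \<xi>'(2) by (intro add_left_mono mult_left_mono) (auto simp: r'eq)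
      also have "\<dots> \<le> E \<zeta> (\<lambda>x. (poly r' x)\<^sup>2)" unfolding E\<zeta> using \<alpha> \<gamma> by simp
      finally show "p * c / (p + c) * (poly r x)\<^sup>2 + (1 - \<alpha>) * (S - 3 * \<epsilon>) \<le> E \<zeta> (\<lambda>x. (poly r' x)\<^sup>2)"
        by simp
    qed
    also have "\<dots> \<le> S" by (rule TS) fact
    finally have "p * c / (p + c) * (poly r x)\<^sup>2 \<le> \<alpha> * S + (1 - \<alpha>) * (3 * \<epsilon>)"
      by (simp add: algebra_simps)
    also have "\<dots> \<le> \<alpha> * (Rbar m a b + 3 * \<alpha>)"
    proof -
      have "\<alpha> * S \<le> \<alpha> * Rbar m a b" using SR \<alpha> by (intro mult_left_mono) auto
      moreover have "(1 - \<alpha>) * (3 * \<epsilon>) \<le> 1 * (3 * \<epsilon>)" using \<alpha> \<epsilon> by (intro mult_right_mono) auto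
      ultimately show ?thesis by (simp add: distrib_left \<epsilon>_def power2_eq_square)
    qed
    finally have "(poly r x)\<^sup>2 \<le> \<alpha> * (Rbar m a b + 3 * \<alpha>) * (1 / p + 1 / c)"
      using pc by (simp add: field_simps)
    also have "\<dots> = (Rbar m a b + 3 * \<gamma>\<^sup>2) * (\<alpha> / p + \<alpha> / c)"
      by (simp add: algebra_simps \<alpha>_def)
    also have "\<alpha> / p = 1 / (1 - \<gamma>)" using \<alpha> by (simp add: p_def)
    also have "\<alpha> / c = 2 * K * \<gamma> / (1 - \<gamma>\<^sup>2)"
      using \<gamma> by (simp add: c_def \<alpha>_def power2_eq_square)
    finally show "(poly r x)\<^sup>2 \<le> (Rbar m a b + 3 * \<gamma>\<^sup>2) * (1 / (1 - \<gamma>) + 2 * K * \<gamma> / (1 - \<gamma>\<^sup>2))" .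
  qed
qed

text \<open>One half of the minimax theorem: the largest value of \<open>Tbar\<close> is not smaller than the best uniform
approximation error.\<close>

lemma near_minimax:
  assumes m: "m \<ge> 2" and a: "a > 0" and \<eta>: "\<eta> > 0"
  obtains r where "r \<in> gap_polys m b" "\<And>x. \<bar>x\<bar> \<le> a \<Longrightarrow> (poly r x)\<^sup>2 \<le> Rbar m a b + \<eta>"
proof -
  obtain \<mu> K where \<mu>: "approximate_design a \<mu>" "K > 0"
    "\<And>d x. degree d \<le> m - 2 \<Longrightarrow> \<bar>x\<bar> \<le> a \<Longrightarrow> (poly d x)\<^sup>2 \<le> K * E \<mu> (\<lambda>x. (poly d x)\<^sup>2)"
    using sup_norm_le_design_norm[OF a, of "m - 2"] by blast
  define B where "B \<gamma> = (Rbar m a b + 3 * \<gamma>\<^sup>2) * (1 / (1 - \<gamma>) + 2 * K * \<gamma> / (1 - \<gamma>\<^sup>2))" for \<gamma>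
  have "(B \<longlongrightarrow> Rbar m a b) (at_right 0)"
    unfolding B_def by (auto intro!: tendsto_eq_intros)
  then have "\<forall>\<^sub>F \<gamma> in at_right 0. B \<gamma> < Rbar m a b + \<eta>"
    by (rule order_tendstoD) (use \<eta> in simp)
  moreover have "\<forall>\<^sub>F \<gamma> :: real in at_right 0. 0 < \<gamma> \<and> \<gamma> < 1"
    by (rule eventually_at_rightI[of 0 1]) auto
  ultimately have "\<forall>\<^sub>F \<gamma> in at_right 0. B \<gamma> < Rbar m a b + \<eta> \<and> 0 < \<gamma> \<and> \<gamma> < 1"
    by eventually_elim auto
  then obtain \<gamma> where \<gamma>: "B \<gamma> < Rbar m a b + \<eta>" "0 < \<gamma>" "\<gamma> < 1"
    using eventually_happens trivial_limit_at_right_real by blast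
  from near_minimax_step[OF m a \<gamma>(2,3) \<mu>, of b, folded B_def] obtain r
    where r: "r \<in> gap_polys m b" "\<And>x. \<bar>x\<bar> \<le> a \<Longrightarrow> (poly r x)\<^sup>2 \<le> B \<gamma>" by blast
  show thesis by (rule that[OF r(1)]) (use r(2) \<gamma>(1) in force)
qed

text \<open>Reflection at the origin maps \<open>gap_polys m b\<close> to \<open>gap_polys m (-b)\<close>, up to the sign.\<close>

lemma Rbar_uminus:
  assumes m: "m \<ge> 2" and a: "a > 0" shows "Rbar m a (-b) = Rbar m a b"
proof -
  have le: "Rbar m a (-b) \<le> Rbar m a b" for b
  proof (rule field_le_epsilon)
    fix \<eta> :: real assume "\<eta> > 0"
    then obtain r where r: "r \<in> gap_polys m b" "\<And>x. \<bar>x\<bar> \<le> a \<Longrightarrow> (poly r x)\<^sup>2 \<le> Rbar m a b + \<eta>"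
      using near_minimax[OF m a] by blast
    define r' where "r' = smult ((-1) ^ m) (pcompose r [:0, -1:])"
    have "r' \<in> gap_polys m (-b)"
    proof -
      have "(-1) ^ m * (-1) ^ (m - 1) = (-1 :: real)"
        using m by (cases m) (auto simp flip: power_mult_distrib)
      then show ?thesis
        using r(1) by (auto simp: gap_polys_def r'_def coeff_pcompose_linear degree_pcompose
          mult.assoc[symmetric] simp flip: power_mult_distrib intro: order.trans[OF degree_smult_le])
    qed
    moreover have "(poly r' x)\<^sup>2 = (poly r (-x))\<^sup>2" for x
      by (simp add: r'_def poly_pcompose power_mult_distrib flip: power_mult)
    ultimately show "Rbar m a (-b) \<le> Rbar m a b + \<eta>"
      using r(2) by (intro Rbar_least[OF a] order.trans[OF Tbar_le[OF m]] design_le_const) auto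
  qed
  show ?thesis using le[of b] le[of "-b"] by simp
qed

lemma minimax_rescale:
  fixes a b y :: real
  assumes "m \<ge> 1" "a > 0" and c: "\<And>i. i \<le> m - 2 \<Longrightarrow> c i * a ^ i = a ^ m * q i"
  shows "a ^ (2 * m) * \<bar>y ^ m + b / a * y ^ (m - 1) + (\<Sum>i\<le>m - 2. q i * y ^ i)\<bar>\<^sup>2
    = ((a * y) ^ m + b * (a * y) ^ (m - 1) + (\<Sum>i\<le>m - 2. c i * (a * y) ^ i))\<^sup>2"
proof -
  have "(\<Sum>i\<le>m - 2. c i * (a * y) ^ i) = a ^ m * (\<Sum>i\<le>m - 2. q i * y ^ i)"
    unfolding sum_distrib_left
    by (intro sum.cong) (simp_all add: power_mult_distrib c mult.assoc[symmetric])
  moreover have "b * (a * y) ^ (m - 1) = a ^ m * (b / a * y ^ (m - 1))"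
    using assms by (cases m) (auto simp: power_mult_distrib)
  ultimately have "(a * y) ^ m + b * (a * y) ^ (m - 1) + (\<Sum>i\<le>m - 2. c i * (a * y) ^ i)
      = a ^ m * (y ^ m + b / a * y ^ (m - 1) + (\<Sum>i\<le>m - 2. q i * y ^ i))"
    by (simp add: algebra_simps power_mult_distrib)
  moreover have "a ^ (2 * m) = (a ^ m)\<^sup>2" by (simp add: power_mult[symmetric] mult.commute)
  ultimately show ?thesis by (simp add: power_mult_distrib)
qed

text \<open>The inequality from left to right is \<open>near_minimax\<close>; the other one holds since the mean square of a
residual is at most its maximum.\<close>

lemma Rbar_minimax_eq:
  assumes m: "m \<ge> 2" and a: "a > 0"
  shows "Rbar_minimax m b a = Rbar m a b"
proof -
  define F where "F q y = a ^ (2 * m) *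
    \<bar>y ^ m + b / a * y ^ (m - 1) + (\<Sum>i\<le>m - 2. q i * y ^ i)\<bar>\<^sup>2" for q :: "nat \<Rightarrow> real" and y
  have ay: "\<bar>a * y\<bar> \<le> a" if "y \<in> {-1..1}" for y
  proof -
    have "\<bar>y\<bar> \<le> 1" using that by auto
    then show ?thesis using a mult_left_mono[of "\<bar>y\<bar>" 1 a] by (simp add: abs_mult)
  qed
  have ya: "x / a \<in> {-1..1}" if "\<bar>x\<bar> \<le> a" for x using that a by (auto simp: divide_simps)
  have bdd: "bdd_above (F q ` {-1..1})" for q
  proof -
    have "compact (F q ` {-1..1})"
      unfolding F_def by (intro compact_continuous_image continuous_intros) simp
    then show ?thesis by (intro bounded_imp_bdd_above compact_imp_bounded)
  qed
  have F0: "F q y \<ge> 0" for q y using a by (simp add: F_def)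
  have S0: "(SUP y\<in>{-1..1}. F q y) \<ge> 0" for q
    by (rule cSUP_upper2[OF bdd, of 0]) (auto simp: F0)
  have "Rbar m a b \<le> (SUP y\<in>{-1..1}. F q y)" for q
  proof -
    obtain r where r: "r \<in> gap_polys m b"
      "\<And>x. poly r x = x ^ m + b * x ^ (m - 1) + (\<Sum>i\<le>m - 2. (a ^ m * q i / a ^ i) * x ^ i)"
      using gap_polys_of_coeffs[OF m] by metis
    have "F q y = (poly r (a * y))\<^sup>2" for y
      unfolding F_def r(2) using m a by (intro minimax_rescale) auto
    then have "(poly r x)\<^sup>2 \<le> (SUP y\<in>{-1..1}. F q y)" if "\<bar>x\<bar> \<le> a" for x
      using cSUP_upper[OF ya[OF that] bdd, of q] a by simp
    then show ?thesis
      by (intro Rbar_least[OF a] order.trans[OF Tbar_le[OF m r(1)]] design_le_const) auto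
  qed
  moreover have "\<exists>q. (SUP y\<in>{-1..1}. F q y) \<le> Rbar m a b + \<eta>" if "\<eta> > 0" for \<eta>
  proof -
    obtain r where r: "r \<in> gap_polys m b" "\<And>x. \<bar>x\<bar> \<le> a \<Longrightarrow> (poly r x)\<^sup>2 \<le> Rbar m a b + \<eta>"
      using near_minimax[OF m a \<open>\<eta> > 0\<close>] by blast
    define q where "q i = coeff r i * a ^ i / a ^ m" for i
    have "F q y = (poly r (a * y))\<^sup>2" for y
      unfolding F_def poly_gap_polys[OF m r(1)] using m a
      by (intro minimax_rescale) (auto simp: q_def)
    then have "(SUP y\<in>{-1..1}. F q y) \<le> Rbar m a b + \<eta>"
      using r(2) ay by (intro cSUP_least) auto
    then show ?thesis by blast
  qed
  then have "(INF q. SUP y\<in>{-1..1}. F q y) \<le> Rbar m a b + \<eta>" if "\<eta> > 0" for \<eta>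
    using that S0 by (metis (no_types, lifting) UNIV_I bdd_belowI2 cINF_lower2)
  then have "(INF q. SUP y\<in>{-1..1}. F q y) \<le> Rbar m a b" by (rule field_le_epsilon)
  ultimately have "(INF q. SUP y\<in>{-1..1}. F q y) = Rbar m a b"
    by (intro antisym cINF_greatest) auto
  then show ?thesis unfolding Rbar_minimax_def F_def .
qed

section \<open>Existence and uniqueness of the maximizer\<close>

text \<open>Comparing \<open>Rbar m a b\<close> with \<open>1 + 2 (b / a)\<^sup>2\<close> makes later estimates uniform in \<open>b\<close> for
unbounded parameter sets. The lower bound comes from the design with \<open>\<beta> = 0\<close>.\<close>

lemma Rbar_bounds:
  assumes m: "m \<ge> 2" and a: "a > 0"
  shows "gap_scale m a * (2 * (b / a)\<^sup>2 + 1) \<le> Rbar m a b"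
    and "Rbar m a b \<le> 4 * gap_scale m a * (2 * (b / a)\<^sup>2 + 1)"
proof -
  obtain \<xi> where \<xi>: "approximate_design a \<xi>"
    "Tbar m \<xi> b = gap_scale m a * ((1 + 0) * (2 * (b / a)\<^sup>2 + (1 - 0)))"
    using xi_design[OF m order.refl zero_le_one a] by blast
  show "gap_scale m a * (2 * (b / a)\<^sup>2 + 1) \<le> Rbar m a b"
    using Tbar_le_Rbar[OF m \<xi>(1), of b] \<xi>(2) by simp
  have s: "gap_scale m a > 0" using a by (simp add: gap_scale_def)
  show "Rbar m a b \<le> 4 * gap_scale m a * (2 * (b / a)\<^sup>2 + 1)"
  proof (rule Rbar_least[OF a])
    fix \<xi> assume \<xi>: "approximate_design a \<xi>"
    obtain \<beta> where \<beta>: "0 \<le> \<beta>" "\<beta> \<le> 1" "Tbar m \<xi> b + Tbar m \<xi> (-b)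
        \<le> 2 * (gap_scale m a * ((1 + \<beta>) * (2 * (b / a)\<^sup>2 + (1 - \<beta>))))"
      using design_dominated[OF m a \<xi>] by blast
    have "(1 + \<beta>) * (2 * (b / a)\<^sup>2 + (1 - \<beta>)) \<le> 2 * (2 * (b / a)\<^sup>2 + 1)"
      using \<beta> by (intro mult_mono) auto
    then have "2 * (gap_scale m a * ((1 + \<beta>) * (2 * (b / a)\<^sup>2 + (1 - \<beta>))))
        \<le> 2 * (gap_scale m a * (2 * (2 * (b / a)\<^sup>2 + 1)))"
      using s by (intro mult_left_mono) auto
    then show "Tbar m \<xi> b \<le> 4 * gap_scale m a * (2 * (b / a)\<^sup>2 + 1)"
      using \<beta>(3) Tbar_nonneg[OF m, of \<xi> "-b"] by linarith
  qed
qed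

lemma Rbar_pos:
  assumes "m \<ge> 2" "a > 0" shows "Rbar m a b > 0"
proof -
  have "0 < gap_scale m a * (2 * (b / a)\<^sup>2 + 1)"
    using assms by (intro mult_pos_pos add_nonneg_pos) (auto simp: gap_scale_def)
  also have "\<dots> \<le> Rbar m a b" by (rule Rbar_bounds(1)[OF assms])
  finally show ?thesis .
qed

text \<open>Up to the factor \<open>4 * gap_scale m a\<close> this is the standardized value at \<open>b\<close> of the design with
\<open>\<beta> = 1 - 2 h\<close>.\<close>

definition rel_eff :: "nat \<Rightarrow> real \<Rightarrow> real \<Rightarrow> real \<Rightarrow> real" where
  "rel_eff m a b h = ((b / a)\<^sup>2 + h) * (1 - h) / Rbar m a b"

lemma maximin_fun_eq:
  assumes "m \<ge> 2" "a > 0"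
  shows "maximin_fun m a B h = (INF b\<in>B. rel_eff m a b h)"
proof -
  have "(b\<^sup>2 + a\<^sup>2 * h) / (a\<^sup>2 * Rbar_minimax m b a) * (1 - h) = rel_eff m a b h" for b
  proof -
    have "b\<^sup>2 + a\<^sup>2 * h = a\<^sup>2 * ((b / a)\<^sup>2 + h)"
      using assms by (simp add: power_divide distrib_left)
    then show ?thesis using assms by (simp add: rel_eff_def Rbar_minimax_eq)
  qed
  then show ?thesis by (simp add: maximin_fun_def)
qed

lemma rel_eff_nonneg:
  "m \<ge> 2 \<Longrightarrow> a > 0 \<Longrightarrow> 0 \<le> h \<Longrightarrow> h \<le> 1 \<Longrightarrow> rel_eff m a b h \<ge> 0"
  using Rbar_pos[of m a b] by (simp add: rel_eff_def)

lemma rel_eff_lipschitz: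
  assumes m: "m \<ge> 2" and a: "a > 0" and h: "h \<in> {0..1/2}" "h' \<in> {0..1/2}"
  shows "rel_eff m a b h \<le> rel_eff m a b h' + \<bar>h - h'\<bar> / gap_scale m a"
proof -
  define s where "s = (b / a)\<^sup>2"
  have s: "s \<ge> 0" by (simp add: s_def)
  note R = Rbar_pos[OF m a, of b]
  have g: "gap_scale m a > 0" using a by (simp add: gap_scale_def)
  have "rel_eff m a b h - rel_eff m a b h' = (h - h') * (1 - s - h - h') / Rbar m a b"
    by (simp add: rel_eff_def s_def algebra_simps flip: diff_divide_distrib)
  also have "\<dots> \<le> \<bar>h - h'\<bar> * (2 * s + 1) / Rbar m a b"
  proof -
    have "\<bar>1 - s - h - h'\<bar> \<le> 2 * s + 1" using h s by auto
    then have "\<bar>h - h'\<bar> * \<bar>1 - s - h - h'\<bar> \<le> \<bar>h - h'\<bar> * (2 * s + 1)"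
      by (intro mult_left_mono) auto
    then show ?thesis using R by (intro divide_right_mono) (auto simp flip: abs_mult)
  qed
  also have "\<dots> \<le> \<bar>h - h'\<bar> / gap_scale m a"
  proof -
    have "\<bar>h - h'\<bar> * (gap_scale m a * (2 * s + 1)) \<le> \<bar>h - h'\<bar> * Rbar m a b"
      using Rbar_bounds(1)[OF m a, of b] by (intro mult_left_mono) (auto simp: s_def)
    then show ?thesis using R g by (simp add: divide_simps mult_ac)
  qed
  finally show ?thesis by simp
qed

text \<open>Each function is a strictly concave parabola in \<open>h\<close>, but its curvature \<open>2 / Rbar m a b\<close> tends to zero
for large \<open>b\<close>. In that range, however, the function is decreasing with a slope bounded away from
zero, so that its value at the midpoint is noticeably larger than the one at the right end point.\<close>

lemma rel_eff_midpoint: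
  assumes m: "m \<ge> 2" and a: "a > 0" and h: "h1 \<in> {0..1/2}" "h2 \<in> {0..1/2}" "h1 < h2"
  obtains \<epsilon> where "\<epsilon> > 0" "\<And>b. min (rel_eff m a b h1) (rel_eff m a b h2) + \<epsilon>
    \<le> rel_eff m a b ((h1 + h2) / 2)"
proof -
  define g where "g = gap_scale m a"
  have g: "g > 0" using a by (simp add: gap_scale_def g_def)
  define \<delta> where "\<delta> = h2 - h1"
  have \<delta>: "\<delta> > 0" using h by (simp add: \<delta>_def)
  \<comment> \<open>The first bound is used for \<open>(b / a)\<^sup>2 \<le> 2\<close>, where \<open>Rbar m a b \<le> 20 g\<close>, the second one for larger
\<open>b\<close>.\<close>
  have pos: "min (\<delta>\<^sup>2 / (80 * g)) (\<delta> / (40 * g)) > 0" using g \<delta> by simp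
  show thesis
  proof (rule that[OF pos])
    fix b
    define s where "s = (b / a)\<^sup>2"
    have s: "s \<ge> 0" by (simp add: s_def)
    define R where "R = Rbar m a b"
    have R: "R > 0" unfolding R_def by (rule Rbar_pos[OF m a])
    have Ru: "R \<le> 4 * g * (2 * s + 1)"
      unfolding R_def g_def s_def by (rule Rbar_bounds(2)[OF m a])
    have e: "rel_eff m a b h = (s + h) * (1 - h) / R" for h
      by (simp add: rel_eff_def s_def R_def)
    show "min (rel_eff m a b h1) (rel_eff m a b h2) + min (\<delta>\<^sup>2 / (80 * g)) (\<delta> / (40 * g))
        \<le> rel_eff m a b ((h1 + h2) / 2)"
    proof (cases "s \<le> 2")
      case True
      have "rel_eff m a b ((h1 + h2) / 2) - (rel_eff m a b h1 + rel_eff m a b h2) / 2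
          = ((s + (h1 + h2) / 2) * (1 - (h1 + h2) / 2)
              - ((s + h1) * (1 - h1) + (s + h2) * (1 - h2)) / 2) / R"
        unfolding e by (simp add: diff_divide_distrib add_divide_distrib)
      also have "(s + (h1 + h2) / 2) * (1 - (h1 + h2) / 2)
              - ((s + h1) * (1 - h1) + (s + h2) * (1 - h2)) / 2 = \<delta>\<^sup>2 / 4"
        by (simp add: \<delta>_def field_simps power2_eq_square)
      finally have eq: "rel_eff m a b ((h1 + h2) / 2)
          = (rel_eff m a b h1 + rel_eff m a b h2) / 2 + \<delta>\<^sup>2 / 4 / R" by simp
      have "4 * g * (2 * s + 1) \<le> 4 * g * 5" using True g by (intro mult_left_mono) auto
      then have "R \<le> 20 * g" using Ru by simp
      then have "\<delta>\<^sup>2 / 4 / (20 * g) \<le> \<delta>\<^sup>2 / 4 / R" using R g by (intro divide_left_mono) auto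
      moreover have "\<delta>\<^sup>2 / 4 / (20 * g) = \<delta>\<^sup>2 / (80 * g)" by simp
      moreover have "min (rel_eff m a b h1) (rel_eff m a b h2)
          \<le> (rel_eff m a b h1 + rel_eff m a b h2) / 2" by (simp add: min_def)
      ultimately show ?thesis
        unfolding eq using min.cobounded1[of "\<delta>\<^sup>2 / (80 * g)" "\<delta> / (40 * g)"] by linarith
    next
      case False
      define q where "q = s + (h1 + h2) / 2 + h2 - 1"
      have "rel_eff m a b ((h1 + h2) / 2) - rel_eff m a b h2
          = ((s + (h1 + h2) / 2) * (1 - (h1 + h2) / 2) - (s + h2) * (1 - h2)) / R"
        unfolding e by (simp add: diff_divide_distrib)
      also have "(s + (h1 + h2) / 2) * (1 - (h1 + h2) / 2) - (s + h2) * (1 - h2)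
          = \<delta> / 2 * (s + (h1 + h2) / 2 + h2 - 1)"
        by (simp add: \<delta>_def field_simps power2_eq_square)
      finally have eq: "rel_eff m a b ((h1 + h2) / 2) - rel_eff m a b h2 = \<delta> / 2 * q / R"
        by (simp add: q_def)
      have "2 * s + 1 \<le> 5 * q"
      proof -
        have "0 \<le> (h1 + h2) / 2" "0 \<le> h2" using h by auto
        then show ?thesis
          using False unfolding q_def distrib_left right_diff_distrib by linarith
      qed
      then have "4 * g * (2 * s + 1) \<le> 4 * g * (5 * q)" using g by (intro mult_left_mono) auto
      then have Rq: "\<delta> / 2 * R \<le> \<delta> / 2 * (20 * g * q)"
        using Ru \<delta> by (intro mult_left_mono) auto
      have "\<delta> / (40 * g) * R = \<delta> / 2 * R / (20 * g)" by simp
      also have "\<dots> \<le> \<delta> / 2 * (20 * g * q) / (20 * g)"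
        using Rq g by (intro divide_right_mono) auto
      also have "\<dots> = \<delta> / 2 * q" using g by simp
      finally have "\<delta> / (40 * g) \<le> \<delta> / 2 * q / R" using R by (simp only: pos_le_divide_eq)
      then show ?thesis
        using eq min.cobounded2[of "\<delta>\<^sup>2 / (80 * g)" "\<delta> / (40 * g)"]
          min.cobounded2[of "rel_eff m a b h1" "rel_eff m a b h2"] by linarith
    qed
  qed
qed

text \<open>The infimum of functions with a common Lipschitz constant is Lipschitz, so the maximum is attained. The
midpoint of two maximizers would have a larger value.\<close>

lemma h_star_ex1:
  assumes m: "m \<ge> 2" and a: "a > 0" and B: "B \<noteq> {}"
  shows "\<exists>!h. is_h_star m a B h"
proof -
  define F where "F = maximin_fun m a B"
  have F: "F h = (INF b\<in>B. rel_eff m a b h)" for h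
    unfolding F_def by (rule maximin_fun_eq[OF m a])
  have bdd: "bdd_below ((\<lambda>b. rel_eff m a b h) ` B)" if "h \<in> {0..1/2}" for h
    using that by (intro bdd_belowI2[where m = 0] rel_eff_nonneg[OF m a]) auto
  have g: "gap_scale m a > 0" using a by (simp add: gap_scale_def)
  have lip: "F h \<le> F h' + \<bar>h - h'\<bar> / gap_scale m a" if h: "h \<in> {0..1/2}" "h' \<in> {0..1/2}" for h h'
  proof -
    have "F h - \<bar>h - h'\<bar> / gap_scale m a \<le> rel_eff m a b h'" if "b \<in> B" for b
      using cINF_lower[OF bdd[OF h(1)] that] rel_eff_lipschitz[OF m a h, of b] F by simp
    then have "F h - \<bar>h - h'\<bar> / gap_scale m a \<le> F h'"
      unfolding F[of h'] by (intro cINF_greatest B)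
    then show ?thesis by simp
  qed
  have "(1 / gap_scale m a)-lipschitz_on {0..1/2} F"
  proof (rule lipschitz_onI)
    fix h h' :: real assume h: "h \<in> {0..1/2}" "h' \<in> {0..1/2}"
    show "dist (F h) (F h') \<le> 1 / gap_scale m a * dist h h'"
      using lip[OF h] lip[OF h(2,1)] by (simp add: dist_real_def abs_minus_commute abs_le_iff)
  qed (use g in simp)
  then have "continuous_on {0..1/2} F" by (rule lipschitz_on_continuous_on)
  then obtain h where h: "h \<in> {0..1/2}" "\<And>h'. h' \<in> {0..1/2} \<Longrightarrow> F h' \<le> F h"
    using continuous_attains_sup[of "{0..1/2::real}" F] by auto
  have star: "is_h_star m a B h \<longleftrightarrow> h \<in> {0..1/2} \<and> (\<forall>h'\<in>{0..1/2}. F h' \<le> F h)" for h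
    unfolding is_h_star_def is_arg_max_def F_def by (auto simp: not_less)
  have no: False if h: "h1 \<in> {0..1/2}" "h2 \<in> {0..1/2}" "h1 < h2" and eq: "F h1 = F h2"
    and max: "\<forall>h'\<in>{0..1/2}. F h' \<le> F h1" for h1 h2
  proof -
    obtain \<epsilon> where \<epsilon>: "\<epsilon> > 0" "\<And>b. min (rel_eff m a b h1) (rel_eff m a b h2) + \<epsilon>
        \<le> rel_eff m a b ((h1 + h2) / 2)"
      by (rule rel_eff_midpoint[OF m a h]) (rule that; assumption)
    have "F h1 + \<epsilon> \<le> rel_eff m a b ((h1 + h2) / 2)" if "b \<in> B" for b
      using cINF_lower[OF bdd[OF h(1)] that] cINF_lower[OF bdd[OF h(2)] that] \<epsilon>(2)[of b] eq F
      by (auto simp: min_def split: if_splits)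
    then have "F h1 + \<epsilon> \<le> F ((h1 + h2) / 2)"
      unfolding F[of "(h1 + h2) / 2"] by (intro cINF_greatest B)
    moreover have "(h1 + h2) / 2 \<in> {0..1/2}" using h by auto
    ultimately show False using max \<epsilon>(1) by fastforce
  qed
  show ?thesis
  proof (rule ex1I[of _ h])
    show "is_h_star m a B h" using h star by blast
    fix h' assume "is_h_star m a B h'"
    then have h': "h' \<in> {0..1/2}" "\<forall>k\<in>{0..1/2}. F k \<le> F h'" using star by auto
    then have "F h = F h'" using h by (meson order_antisym)
    then show "h' = h" using no[of h h'] no[of h' h] h h' by (metis linorder_neqE)
  qed
qed

section \<open>Optimality\<close>

text \<open>Since \<open>B\<close> contains \<open>-b\<close> together with \<open>b\<close> and \<open>Rbar\<close> is even in \<open>b\<close>, the infimum is bounded by the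
average of the values at \<open>b\<close> and \<open>-b\<close>, to which \<open>design_dominated\<close> applies.\<close>

lemma maximin_optimal:
  assumes m: "m \<ge> 2" and a: "a > 0" and B: "B \<noteq> {}" "uminus ` B = B"
  shows "\<exists>\<xi>. pmf \<xi> = xi_mass m a (beta_M m a B) \<and> standardized_maximin_T_optimal m a B \<xi>"
proof -
  define g where "g = gap_scale m a"
  have g: "g > 0" using a by (simp add: gap_scale_def g_def)
  define h where "h = (THE h. is_h_star m a B h)"
  have "is_h_star m a B h" unfolding h_def by (rule theI'[OF h_star_ex1[OF m a B(1)]])
  then have h: "h \<in> {0..1/2}"
    "\<And>k. k \<in> {0..1/2} \<Longrightarrow> maximin_fun m a B k \<le> maximin_fun m a B h"
    unfolding is_h_star_def is_arg_max_def by (auto simp: not_less)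
  have \<beta>: "beta_M m a B = 1 - 2 * h" by (simp add: beta_M_def h_def)
  have h01: "0 \<le> 1 - 2 * h" "1 - 2 * h \<le> 1" using h(1) by auto
  obtain \<xi> where \<xi>: "pmf \<xi> = xi_mass m a (beta_M m a B)" "approximate_design a \<xi>"
    "\<And>b. Tbar m \<xi> b = gap_scale m a * ((1 + (1 - 2 * h)) * (2 * (b / a)\<^sup>2 + (1 - (1 - 2 * h))))"
    using xi_design[OF m h01 a] unfolding \<beta> by blast
  have eff: "gap_scale m a * ((1 + (1 - 2 * k)) * (2 * (b / a)\<^sup>2 + (1 - (1 - 2 * k)))) / Rbar m a b
      = 4 * g * rel_eff m a b k" for b k
    by (simp add: rel_eff_def g_def algebra_simps)
  have bdd: "bdd_below ((\<lambda>b. rel_eff m a b k) ` B)" if "k \<in> {0..1/2}" for k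
    using that by (intro bdd_belowI2[where m = 0] rel_eff_nonneg[OF m a]) auto
  have low: "4 * g * maximin_fun m a B h \<le> V_M m a B \<xi>"
    unfolding V_M_def
  proof (rule cINF_greatest[OF B(1)])
    fix b assume "b \<in> B"
    then have "maximin_fun m a B h \<le> rel_eff m a b h"
      unfolding maximin_fun_eq[OF m a] by (intro cINF_lower bdd h(1))
    then show "4 * g * maximin_fun m a B h \<le> Tbar m \<xi> b / Rbar m a b"
      unfolding \<xi>(3) eff using g by simp
  qed
  have up: "V_M m a B \<zeta> \<le> 4 * g * maximin_fun m a B h" if \<zeta>: "approximate_design a \<zeta>" for \<zeta>
  proof -
    obtain \<beta>' where \<beta>': "0 \<le> \<beta>'" "\<beta>' \<le> 1" "\<And>b. Tbar m \<zeta> b + Tbar m \<zeta> (-b)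
        \<le> 2 * (gap_scale m a * ((1 + \<beta>') * (2 * (b / a)\<^sup>2 + (1 - \<beta>'))))"
      using design_dominated[OF m a \<zeta>] by blast
    define k where "k = (1 - \<beta>') / 2"
    have k: "k \<in> {0..1/2}" and \<beta>k: "\<beta>' = 1 - 2 * k" using \<beta>' by (auto simp: k_def field_simps)
    have bddT: "bdd_below ((\<lambda>b. Tbar m \<zeta> b / Rbar m a b) ` B)"
      using Tbar_nonneg[OF m] Rbar_pos[OF m a]
      by (intro bdd_belowI2[where m = 0]) (simp add: less_imp_le)
    have "V_M m a B \<zeta> / (4 * g) \<le> maximin_fun m a B k"
      unfolding maximin_fun_eq[OF m a]
    proof (rule cINF_greatest[OF B(1)])
      fix b assume b: "b \<in> B"
      then have "-b \<in> B" using B(2) by blast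
      have "V_M m a B \<zeta> \<le> Tbar m \<zeta> b / Rbar m a b" "V_M m a B \<zeta> \<le> Tbar m \<zeta> (-b) / Rbar m a (-b)"
        unfolding V_M_def using b \<open>-b \<in> B\<close> by (auto intro!: cINF_lower bddT)
      then have "2 * V_M m a B \<zeta> \<le> (Tbar m \<zeta> b + Tbar m \<zeta> (-b)) / Rbar m a b"
        by (simp add: Rbar_uminus[OF m a] add_divide_distrib)
      also have "\<dots> \<le> 2 * (gap_scale m a * ((1 + \<beta>') * (2 * (b / a)\<^sup>2 + (1 - \<beta>')))) / Rbar m a b"
        using \<beta>'(3) Rbar_pos[OF m a, of b] by (intro divide_right_mono) auto
      also have "\<dots> = 2 * (4 * g * rel_eff m a b k)"
        unfolding \<beta>k eff[symmetric] by simp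
      finally show "V_M m a B \<zeta> / (4 * g) \<le> rel_eff m a b k"
        using g by (simp add: divide_le_eq mult_ac)
    qed
    also have "\<dots> \<le> maximin_fun m a B h" by (rule h(2)[OF k])
    finally show ?thesis using g by (simp add: divide_le_eq mult_ac)
  qed
  have "standardized_maximin_T_optimal m a B \<xi>"
    unfolding standardized_maximin_T_optimal_def is_arg_max_def
    using \<xi>(2) low up by (meson order.trans not_less)
  with \<xi>(1) show ?thesis by blast
qed

text \<open>If \<open>Tbar\<close> is not integrable for a competing design, its criterion is \<open>0\<close> by convention, and the
comparison is trivial. Otherwise write \<open>4 s = 4 \<beta> + 4 (s - \<beta>)\<close>: the first part is estimated together with
\<open>J\<^sup>2\<close> by the equioscillation bound, the second by \<open>T\<^sub>n\<^sup>2 \<le> 1\<close>.\<close>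

lemma bayesian_optimal:
  assumes m: "m \<ge> 2" and a: "a > 0" and \<pi>: "symmetric_prior B \<pi>" and sq: "integrable \<pi> (\<lambda>b. b\<^sup>2)"
  shows "\<exists>\<xi>. pmf \<xi> = xi_mass m a (beta_B a \<pi>) \<and> bayesian_T_optimal m a \<pi> \<xi>"
proof -
  interpret prob_space \<pi> using \<pi> by (simp add: symmetric_prior_def)
  have id: "(\<lambda>b. b) \<in> borel_measurable \<pi>"
  proof -
    have "(\<lambda>b. b) \<in> borel_measurable (restrict_space borel B)"
      by (intro measurable_restrict_space1) simp
    moreover have "sets \<pi> = sets (restrict_space borel B)"
      using \<pi> by (simp add: symmetric_prior_def)
    ultimately show ?thesis using measurable_cong_sets by blast
  qed
  have int: "integrable \<pi> (\<lambda>b. b)"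
  proof (rule Bochner_Integration.integrable_bound[of _ "\<lambda>b. 1 + b\<^sup>2"])
    show "integrable \<pi> (\<lambda>b. 1 + b\<^sup>2)" using sq by simp
    have "\<bar>b\<bar> \<le> 1 + b\<^sup>2" for b :: real
      using zero_le_power2[of "\<bar>b\<bar> - 1 / 2"] by (simp add: power2_diff algebra_simps power_divide)
    then show "AE b in \<pi>. norm b \<le> norm (1 + b\<^sup>2)" by simp
  qed (fact id)
  have mean: "(\<integral>b. b \<partial>\<pi>) = 0"
  proof -
    have "(\<integral>b. - b \<partial>\<pi>) = (\<integral>x. x \<partial>distr \<pi> borel uminus)"
      using id by (subst integral_distr) auto
    also have "\<dots> = (\<integral>x. x \<partial>distr \<pi> borel (\<lambda>b. b))" using \<pi> by (simp add: symmetric_prior_def)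
    also have "\<dots> = (\<integral>b. b \<partial>\<pi>)" using id by (subst integral_distr) auto
    finally show ?thesis using int by simp
  qed
  define s where "s = (\<integral>b. b\<^sup>2 \<partial>\<pi>) / a\<^sup>2"
  have s0: "s \<ge> 0" by (simp add: s_def)
  have quad: "integrable \<pi> (\<lambda>b. c * (u + 4 * b / a * v + 4 * (b / a)\<^sup>2 * w))"
    "(\<integral>b. c * (u + 4 * b / a * v + 4 * (b / a)\<^sup>2 * w) \<partial>\<pi>) = c * (u + 4 * s * w)" for c u v w
  proof -
    have eq: "(\<lambda>b. c * (u + 4 * b / a * v + 4 * (b / a)\<^sup>2 * w))
        = (\<lambda>b. c * u + (c * (4 * v / a)) * b + (c * (4 * w / a\<^sup>2)) * b\<^sup>2)"
      by (intro ext) (simp add: algebra_simps power_divide)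
    show "integrable \<pi> (\<lambda>b. c * (u + 4 * b / a * v + 4 * (b / a)\<^sup>2 * w))"
      unfolding eq using int sq by simp
    show "(\<integral>b. c * (u + 4 * b / a * v + 4 * (b / a)\<^sup>2 * w) \<partial>\<pi>) = c * (u + 4 * s * w)"
      unfolding eq using int sq by (simp add: mean prob_space s_def algebra_simps)
  qed
  define \<beta> where "\<beta> = beta_B a \<pi>"
  have \<beta>: "0 \<le> \<beta>" "\<beta> \<le> 1" "\<beta> \<le> s" using s0 by (auto simp: \<beta>_def beta_B_def s_def)
  \<comment> \<open>either \<open>\<beta> = s\<close>, or \<open>\<beta> = 1\<close> and both sides are \<open>4 s\<close>\<close>
  have best: "(1 + \<beta>)\<^sup>2 + 4 * (s - \<beta>) = (1 + \<beta>) * (2 * s + (1 - \<beta>))"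
  proof (cases "s \<le> 1")
    case True
    then have "\<beta> = s" by (simp add: \<beta>_def beta_B_def s_def)
    then show ?thesis by (simp add: algebra_simps power2_eq_square)
  next
    case False
    then have "\<beta> = 1" by (simp add: \<beta>_def beta_B_def s_def)
    then show ?thesis by simp
  qed
  define g where "g = gap_scale m a"
  have g: "g > 0" using a by (simp add: gap_scale_def g_def)
  obtain \<xi> where \<xi>: "pmf \<xi> = xi_mass m a \<beta>" "approximate_design a \<xi>"
    "\<And>b. Tbar m \<xi> b = g * ((1 + \<beta>) * (2 * (b / a)\<^sup>2 + (1 - \<beta>)))"
    using xi_design[OF m \<beta>(1,2) a] unfolding g_def by blast
  have val: "V_B m \<pi> \<xi> = g * ((1 + \<beta>) * (2 * s + (1 - \<beta>)))"
  proof -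
    have eq: "Tbar m \<xi>
        = (\<lambda>b. g * ((1 + \<beta>) * (1 - \<beta>) + 4 * b / a * 0 + 4 * (b / a)\<^sup>2 * ((1 + \<beta>) / 2)))"
      unfolding \<xi>(3) by (intro ext) (simp add: \<xi>(3) algebra_simps)
    have "V_B m \<pi> \<xi> = g * ((1 + \<beta>) * (1 - \<beta>) + 4 * s * ((1 + \<beta>) / 2))"
      unfolding V_B_def eq by (rule quad(2))
    then show ?thesis by (simp add: algebra_simps)
  qed
  have up: "V_B m \<pi> \<zeta> \<le> V_B m \<pi> \<xi>" if \<zeta>: "approximate_design a \<zeta>" for \<zeta>
  proof (cases "integrable \<pi> (Tbar m \<zeta>)")
    case True
    define u v w where "u = E \<zeta> (\<lambda>x. (poly (cheb_J \<beta> (m - 1)) (x / a))\<^sup>2)"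
      and "v = E \<zeta> (\<lambda>x. poly (cheb_J \<beta> (m - 1)) (x / a) * poly (cheb_T (m - 1)) (x / a))"
      and "w = E \<zeta> (\<lambda>x. (poly (cheb_T (m - 1)) (x / a))\<^sup>2)"
    have uw: "u + 4 * \<beta> * w \<le> (1 + \<beta>)\<^sup>2" and w: "w \<le> 1"
      unfolding u_def w_def by (rule moment_bounds[OF a \<zeta>])+
    have "V_B m \<pi> \<zeta> \<le> (\<integral>b. g * (u + 4 * b / a * v + 4 * (b / a)\<^sup>2 * w) \<partial>\<pi>)"
      unfolding V_B_def
    proof (rule integral_mono[OF _ quad(1)])
      show "Tbar m \<zeta> b \<le> g * (u + 4 * b / a * v + 4 * (b / a)\<^sup>2 * w)" for b
        unfolding u_def v_def w_def g_def by (rule Tbar_le_moments[OF m a \<zeta>])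
    qed (use True in simp)
    also have "\<dots> = g * (u + 4 * s * w)" by (rule quad(2))
    also have "u + 4 * s * w = (u + 4 * \<beta> * w) + 4 * (s - \<beta>) * w" by (simp add: algebra_simps)
    also have "g * \<dots> \<le> g * ((1 + \<beta>)\<^sup>2 + 4 * (s - \<beta>) * 1)"
      using g uw w \<beta> by (intro mult_left_mono add_mono) auto
    also have "\<dots> = V_B m \<pi> \<xi>" unfolding val best[symmetric] by simp
    finally show ?thesis .
  next
    case False
    then have "V_B m \<pi> \<zeta> = 0" unfolding V_B_def by (rule not_integrable_integral_eq)
    also have "0 \<le> V_B m \<pi> \<xi>" unfolding val using g s0 \<beta> by simp
    finally show ?thesis .
  qed
  have "bayesian_T_optimal m a \<pi> \<xi>"
    unfolding bayesian_T_optimal_def is_arg_max_def using \<xi>(2) up by (auto simp: not_less)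
  with \<xi>(1) show ?thesis unfolding \<beta>_def by blast
qed

theorem theorem4p1:
  fixes m :: nat and a :: real and B :: "real set"
  assumes "m \<ge> 2" and "a > 0"
  shows "(\<forall>\<pi> :: real measure. symmetric_prior B \<pi> \<and> integrable \<pi> (\<lambda>b. b\<^sup>2) \<longrightarrow>
            (\<exists>\<xi>. pmf \<xi> = xi_mass m a (beta_B a \<pi>) \<and> bayesian_T_optimal m a \<pi> \<xi>))
       \<and> (B \<noteq> {} \<and> uminus ` B = B \<longrightarrow>
            (\<exists>!h. is_h_star m a B h) \<and>
            (\<exists>\<xi>. pmf \<xi> = xi_mass m a (beta_M m a B) \<and> standardized_maximin_T_optimal m a B \<xi>))"
proof (intro conjI allI impI)
  fix \<pi> :: "real measure"
  assume "symmetric_prior B \<pi> \<and> integrable \<pi> (\<lambda>b. b\<^sup>2)"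
  then show "\<exists>\<xi>. pmf \<xi> = xi_mass m a (beta_B a \<pi>) \<and> bayesian_T_optimal m a \<pi> \<xi>"
    using bayesian_optimal[OF assms, of B \<pi>] by simp
next
  assume B: "B \<noteq> {} \<and> uminus ` B = B"
  show "\<exists>!h. is_h_star m a B h"
    by (rule h_star_ex1[OF assms]) (use B in simp)
  show "\<exists>\<xi>. pmf \<xi> = xi_mass m a (beta_M m a B) \<and> standardized_maximin_T_optimal m a B \<xi>"
    by (rule maximin_optimal[OF assms]) (use B in simp_all)
qed

end
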